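(* Let $(\mathbb T,v)\in\mathrm{Tab}_\lambda\times\mathbb N_0^N$. Then there is a nonzero $c\in K$ and vectors $u_{v'}\in V_\lambda$ such that $$P_{v,\mathbb T}=c\,x^v\otimes(\mathbb TR_v)+\sum_{v'\lhd v}x^{v'}\otimes u_{v'},$$ i.e. the leading term of $P_{v,\mathbb T}$, up to a constant multiple, is $x^{v,\mathbb T}:=x^v\otimes \mathbb TR_v$.
   Context: $N\ge2$, $q,s$ indeterminates, $K=\mathbb C(q,s)$. Operators act on the right, composed left to right. $\mathcal H_N(s)$ is generated by $T_1,\dots,T_{N-1}$ with $(T_i+1)(T_i-s)=0$ and braid relations. $\lambda$ a partition of $N$ (French convention, rows numbered bottom to top); $\mathrm{Tab}_\lambda$ = reverse standard tableaux (bijective fillings by $1,\dots,N$ strictly decreasing left to right in rows and bottom to top in columns); $\mathrm{CT}_{\mathbb T}[i]$ = column minus row of the cell of $i$; $\mathbb T^{(i,j)}$ exchanges $i,j$. $V_\lambda$ has basis $\mathrm{Tab}_\lambda$, right action $\mathbb TT_i=s\mathbb T$ if $i,i+1$ share a row, $-\mathbb T$ if they share a column, and if $i$ is in a higher row than $i+1$, with $m=\mathrm{CT}_{\mathbb T}[i+1]-\mathrm{CT}_{\mathbb T}[i]>0$, $\mathbb TT_i=\frac{s-1}{1-s^m}\mathbb T+\frac{s(1-s^{m+1})(1-s^{m-1})}{(1-s^m)^2}\mathbb T^{(i,i+1)}$; remaining case determined by this formula for $\mathbb T^{(i,i+1)}$ and the quadratic relation. Permutations act on the right of $\{1,\dots,N\}$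 ($i.(\sigma\tau)=(i.\sigma).\tau$); for reduced $\sigma=s_{i_1}\cdots s_{i_k}$, $\widetilde T_\sigma=T_{i_1}\cdots T_{i_k}$. For $v\in\mathbb N_0^N$, $r_v$ is the permutation with $i.r_v=r_v[i]=\#\{j\le i:v_j\ge v_i\}+\#\{j>i:v_j>v_i\}$, and $R_v=\widetilde T_{r_v}^{-1}$. $\mathcal M_\lambda=K[x_1,\dots,x_N]\otimes V_\lambda$, $x^v=x_1^{v_1}\cdots x_N^{v_N}$; $(p\otimes u)\mathbf T_i=(1-s)\frac{x_{i+1}(p-p^{s_i})}{x_i-x_{i+1}}\otimes u+p^{s_i}\otimes uT_i$, $(p\otimes u)\mathbf w=p(qx_N,x_1,\dots,x_{N-1})\otimes uT_1\cdots T_{N-1}$, $\mathbf T_i^{-1}=s^{-1}(\mathbf T_i+1-s)$, $\Xi_i=s^{i-N}\mathbf T_{i-1}^{-1}\cdots\mathbf T_1^{-1}\mathbf w\mathbf T_{N-1}\cdots\mathbf T_i$. $P_{v,\mathbb T}$ is the unique (up to the normalization fixed by the Yang–Baxter recursion) simultaneous eigenfunction of $\Xi_1,\dots,\Xi_N$ in $\mathcal M_\lambda$ with eigenvalues $P_{v,\mathbb T}\Xi_i=q^{v_i}s^{\mathrm{CT}_{\mathbb T}[r_v[i]]}P_{v,\mathbb T}$ (the nonsymmetric vector-valued Macdonald polynomial; these form a basis of $\mathcal M_\lambda$). Orders: $v^+$ = decreasing rearrangement; $v\preceq v'$ iff all partial sums $\sum_{k\le i}v_k\le\sum_{k\le i}v'_k$;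 $v\trianglelefteq v'$ iff ($v^+\ne v'^+$ and $v^+\preceq v'^+$) or ($v^+=v'^+$ and $v\preceq v'$); $v'\lhd v$ iff $v'\trianglelefteq v$, $v'\ne v$. *)

theory Defs
  imports Complex_Main "HOL-Computational_Algebra.Polynomial"
          "HOL-Computational_Algebra.Fraction_Field"
begin

text \<open>K is the fraction field of C[s][q]; s is the inner, q the outer indeterminate.\<close>
type_synonym K = "complex poly poly fract"

definition qK :: K where "qK = Fract [:0, 1:] 1"
definition sK :: K where "sK = Fract [:[:0, 1:]:] 1"

text \<open>A partition is the list of its row lengths, row 1 = bottom row (French).
  A tableau maps each entry i in {1..N} to its cell (row, column), both 1-based;
  outside {1..N} it is (0,0).\<close>
type_synonym tab = "nat \<Rightarrow> nat \<times> nat"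

definition is_partition :: "nat \<Rightarrow> nat list \<Rightarrow> bool" where
  "is_partition N lam \<longleftrightarrow> sum_list lam = N \<and> (\<forall>x\<in>set lam. 0 < x) \<and> sorted_wrt (\<ge>) lam"

definition cells :: "nat list \<Rightarrow> (nat \<times> nat) set" where
  "cells lam = {(r, c). 1 \<le> r \<and> r \<le> length lam \<and> 1 \<le> c \<and> c \<le> lam ! (r - 1)}"

definition Tab :: "nat \<Rightarrow> nat list \<Rightarrow> tab set" where
  "Tab N lam = {T. bij_betw T {1..N} (cells lam) \<and> (\<forall>i. i \<notin> {1..N} \<longrightarrow> T i = (0, 0))
     \<and> (\<forall>i\<in>{1..N}. \<forall>j\<in>{1..N}. fst (T i) = fst (T j) \<and> snd (T i) < snd (T j) \<longrightarrow> j < i)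
     \<and> (\<forall>i\<in>{1..N}. \<forall>j\<in>{1..N}. snd (T i) = snd (T j) \<and> fst (T i) < fst (T j) \<longrightarrow> j < i)}"

definition row :: "tab \<Rightarrow> nat \<Rightarrow> nat" where "row T i = fst (T i)"
definition col :: "tab \<Rightarrow> nat \<Rightarrow> nat" where "col T i = snd (T i)"

definition CT :: "tab \<Rightarrow> nat \<Rightarrow> int" where "CT T i = int (col T i) - int (row T i)"

definition adjswap :: "nat \<Rightarrow> nat \<Rightarrow> nat" where
  "adjswap j k = (if k = j then Suc j else if k = Suc j then j else k)"

definition tswap :: "tab \<Rightarrow> nat \<Rightarrow> tab" where "tswap T i = T \<circ> adjswap i"

text \<open>Vectors of V_lambda are coefficient functions on tableaux (supported on Tab).\<close>
type_synonym vec = "tab \<Rightarrow> K"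

definition basis :: "tab \<Rightarrow> vec" where "basis T = (\<lambda>T'. if T' = T then 1 else 0)"

definition coef_a :: "nat \<Rightarrow> K" where "coef_a m = (sK - 1) / (1 - sK ^ m)"
definition coef_b :: "nat \<Rightarrow> K" where
  "coef_b m = sK * (1 - sK ^ (m + 1)) * (1 - sK ^ (m - 1)) / (1 - sK ^ m)^2"

text \<open>Action of T_i on a basis tableau. The last case (i in a lower row than i+1) is the one
  determined by the formula for T^(i,i+1) and the quadratic relation: on span{T^(i,i+1), T}
  the trace is s-1 and the determinant -s, which gives
  T T_i = T^(i,i+1) + (s - 1 - a_m) T with m = CT_T[i] - CT_T[i+1].\<close>
definition tabTi :: "nat \<Rightarrow> tab \<Rightarrow> vec" where
  "tabTi i T =
    (if row T i = row T (Suc i) then (\<lambda>T'. sK * basis T T')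
     else if col T i = col T (Suc i) then (\<lambda>T'. - basis T T')
     else if row T (Suc i) < row T i then
       (let m = nat (CT T (Suc i) - CT T i) in
         (\<lambda>T'. coef_a m * basis T T' + coef_b m * basis (tswap T i) T'))
     else
       (let m = nat (CT T i - CT T (Suc i)) in
         (\<lambda>T'. (sK - 1 - coef_a m) * basis T T' + basis (tswap T i) T')))"

definition vTi :: "nat \<Rightarrow> nat list \<Rightarrow> nat \<Rightarrow> vec \<Rightarrow> vec" where
  "vTi N lam i u = (\<lambda>T'. \<Sum>T\<in>Tab N lam. u T * tabTi i T T')"

definition vTinv :: "nat \<Rightarrow> nat list \<Rightarrow> nat \<Rightarrow> vec \<Rightarrow> vec" where
  "vTinv N lam i u = (\<lambda>T'. inverse sK * (vTi N lam i u T' + (1 - sK) * u T'))"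

definition vTs :: "nat \<Rightarrow> nat list \<Rightarrow> nat list \<Rightarrow> vec \<Rightarrow> vec" where
  "vTs N lam ws u = foldl (\<lambda>u j. vTi N lam j u) u ws"

text \<open>Permutations act on the right: the word [i1,...,ik] denotes s_{i1}...s_{ik}, i.e. the
  map i |-> (...(i.s_{i1})...).s_{ik}.\<close>
definition word_perm :: "nat list \<Rightarrow> nat \<Rightarrow> nat" where
  "word_perm ws = foldl (\<lambda>f j. adjswap j \<circ> f) id ws"

definition reduced_word :: "nat \<Rightarrow> (nat \<Rightarrow> nat) \<Rightarrow> nat list \<Rightarrow> bool" where
  "reduced_word N \<sigma> ws \<longleftrightarrow> set ws \<subseteq> {1..<N} \<and> word_perm ws = \<sigma> \<and>
     (\<forall>ws'. set ws' \<subseteq> {1..<N} \<and> word_perm ws' = \<sigma> \<longrightarrow> length ws \<le> length ws')"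

type_synonym mon = "nat \<Rightarrow> nat"

definition expvecs :: "nat \<Rightarrow> mon set" where
  "expvecs N = {v. \<forall>i. i \<notin> {1..N} \<longrightarrow> v i = 0}"

definition rv :: "nat \<Rightarrow> mon \<Rightarrow> nat \<Rightarrow> nat" where
  "rv N v i = (if i \<in> {1..N} then
      card {j\<in>{1..i}. v i \<le> v j} + card {j\<in>{Suc i..N}. v i < v j} else i)"

text \<open>u R_v = u T~_{r_v}^{-1} = u T_{ik}^{-1} ... T_{i1}^{-1} for a reduced word [i1..ik] of r_v\<close>
definition vRv :: "nat \<Rightarrow> nat list \<Rightarrow> mon \<Rightarrow> vec \<Rightarrow> vec" where
  "vRv N lam v u = (let ws = (SOME ws. reduced_word N (rv N v) ws) in
      foldl (\<lambda>u j. vTinv N lam j u) u (rev ws))"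

text \<open>An element is given by its coefficients: F beta is the vector coefficient of x^beta.\<close>
type_synonym melt = "mon \<Rightarrow> vec"

definition melt_valid :: "nat \<Rightarrow> nat list \<Rightarrow> melt \<Rightarrow> bool" where
  "melt_valid N lam F \<longleftrightarrow> finite {\<beta>. F \<beta> \<noteq> (\<lambda>_. 0)} \<and> (\<forall>\<beta>. \<beta> \<notin> expvecs N \<longrightarrow> F \<beta> = (\<lambda>_. 0))
     \<and> (\<forall>\<beta> T'. T' \<notin> Tab N lam \<longrightarrow> F \<beta> T' = 0)"

text \<open>coefficient of x^beta in x_{i+1}(x^alpha - x^{s_i alpha})/(x_i - x_{i+1}), where
  a = alpha_i, b = alpha_{i+1}, c = beta_i, alpha and beta agree off {i,i+1} and
  beta_i + beta_{i+1} = a + b\<close>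
definition dcoef :: "nat \<Rightarrow> nat \<Rightarrow> nat \<Rightarrow> K" where
  "dcoef a b c = (if b \<le> c \<and> c < a then 1 else if a \<le> c \<and> c < b then -1 else 0)"

definition mTi :: "nat \<Rightarrow> nat list \<Rightarrow> nat \<Rightarrow> melt \<Rightarrow> melt" where
  "mTi N lam i F = (\<lambda>\<beta> T'.
     (1 - sK) * (\<Sum>j\<in>{0..\<beta> i + \<beta> (Suc i)}.
         dcoef j (\<beta> i + \<beta> (Suc i) - j) (\<beta> i) * F (\<beta>(i := j, Suc i := \<beta> i + \<beta> (Suc i) - j)) T')
     + vTi N lam i (F (\<beta> \<circ> adjswap i)) T')"

definition mTinv :: "nat \<Rightarrow> nat list \<Rightarrow> nat \<Rightarrow> melt \<Rightarrow> melt" where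
  "mTinv N lam i F = (\<lambda>\<beta> T'. inverse sK * (mTi N lam i F \<beta> T' + (1 - sK) * F \<beta> T'))"

text \<open>(p (x) u) w = p(q x_N, x_1, ..., x_{N-1}) (x) u T_1 ... T_{N-1}; on monomials
  x^alpha |-> q^{alpha_1} x_1^{alpha_2} ... x_{N-1}^{alpha_N} x_N^{alpha_1}.\<close>
definition mw :: "nat \<Rightarrow> nat list \<Rightarrow> melt \<Rightarrow> melt" where
  "mw N lam F = (\<lambda>\<beta>. if \<beta> \<in> expvecs N then
      (let \<alpha> = (\<lambda>k. if k = 1 then \<beta> N else if 2 \<le> k \<and> k \<le> N then \<beta> (k - 1) else 0) in
        (\<lambda>T'. qK ^ \<beta> N * vTs N lam [1..<N] (F \<alpha>) T'))
      else (\<lambda>_. 0))"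

definition mXi :: "nat \<Rightarrow> nat list \<Rightarrow> nat \<Rightarrow> melt \<Rightarrow> melt" where
  "mXi N lam i F = (\<lambda>\<beta> T'. sK powi (int i - int N) *
      foldl (\<lambda>G j. mTi N lam j G)
        (mw N lam (foldl (\<lambda>G j. mTinv N lam j G) F (rev [1..<i]))) (rev [i..<N]) \<beta> T')"

definition psum :: "mon \<Rightarrow> nat \<Rightarrow> nat" where "psum v i = (\<Sum>k\<in>{1..i}. v k)"

definition dom_le :: "nat \<Rightarrow> mon \<Rightarrow> mon \<Rightarrow> bool" where
  "dom_le N v v' \<longleftrightarrow> (\<forall>i\<in>{1..N}. psum v i \<le> psum v' i)"

definition vplus :: "nat \<Rightarrow> mon \<Rightarrow> mon" where
  "vplus N v = (\<lambda>i. if i \<in> {1..N} then rev (sort (map v [1..<Suc N])) ! (i - 1) else 0)"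

definition tri_le :: "nat \<Rightarrow> mon \<Rightarrow> mon \<Rightarrow> bool" where
  "tri_le N v v' \<longleftrightarrow> (vplus N v \<noteq> vplus N v' \<and> dom_le N (vplus N v) (vplus N v'))
                    \<or> (vplus N v = vplus N v' \<and> dom_le N v v')"

definition tri_lt :: "nat \<Rightarrow> mon \<Rightarrow> mon \<Rightarrow> bool" where
  "tri_lt N v v' \<longleftrightarrow> tri_le N v v' \<and> v \<noteq> v'"

end

theory Submission
  imports Defs "HOL-Combinatorics.Permutations"
begin

text \<open>
  Every \<open>\<Xi>\<^sub>i\<close> is triangular for the order \<open>\<lhd>\<close>, and its leading part at \<open>x\<^sup>v\<close> is
  \<open>q\<close> to the power \<open>v\<^sub>i\<close> times the conjugate by \<open>R\<^sub>v\<close> of the Jucys--Murphy element with index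
  \<open>r\<^sub>v[i]\<close>, which is diagonal on tableaux with eigenvalue \<open>s\<close> to the content of \<open>r\<^sub>v[i]\<close>. Hence,
  if \<open>\<beta>\<close> is maximal among the exponents of a joint eigenfunction \<open>F\<close>, then comparing eigenvalues
  forces \<open>\<beta> = v\<close> (\<open>q\<close> and \<open>s\<close> are independent), and the coefficient of \<open>x\<^sup>v\<close>, moved back
  by the inverse of \<open>R\<^sub>v\<close>, has the content vector of \<open>T\<close>, which determines the tableau.
\<close>

section \<open>Coefficients\<close>

text \<open>\<open>F\<close> is an arbitrary joint eigenfunction, so only the coefficient of
  \<open>mXi\<close> at a maximal exponent of \<open>F\<close> has to be computed, and there every
  contribution from above vanishes. At such an exponent each generator inside
  \<open>\<Xi>\<^sub>i\<close> collapses to a multiple of a generator or of its inverse on the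
  tableau module, the choice being a comparison of two exponents. The resulting mixed word
  \<open>lead\<close> is not visibly conjugate to a Jucys-Murphy element. It becomes one by sorting
  the exponents along a reduced word of \<open>rv N v\<close>: each exchange of an ascent conjugates
  \<open>lead\<close> by one generator, and for decreasing exponents the inverses cancel and
  \<open>jm\<close> remains. Only braid, commutation and inverse relations enter, so this part is
  carried out for abstract operators. For tableaux these relations reduce to identities between
  coefficients that depend on axial distances alone. The comparison works for any reduced word,
  hence for the one picked in \<open>vRv\<close>.\<close>

lemma qK_sK_power: "qK ^ a * sK ^ k = Fract (monom (monom 1 k) a) 1"
proof -
  have *: "Fract (p :: complex poly poly) 1 ^ n = Fract (p ^ n) 1" for p n
    by (induction n) (simp_all add: One_fract_def)
  have q: "qK = Fract (monom (monom 1 0) 1) 1" and s: "sK = Fract (monom (monom 1 1) 0) 1"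
    by (simp_all add: qK_def sK_def monom_Suc monom_0 one_pCons)
  show ?thesis
    unfolding q s * by (simp add: monom_power mult_monom)
qed

lemma sK_nonzero [simp]: "sK \<noteq> 0"
  by (simp add: sK_def Zero_fract_def eq_fract)

text \<open>A common factor \<open>sK powi t\<close> clears the negative exponents, after which two
  monomials of the polynomial ring are compared.\<close>

lemma qK_sK_independent:
  assumes "qK ^ a * sK powi m = qK ^ b * sK powi n"
  shows "a = b" and "m = n"
proof -
  define t where "t = \<bar>m\<bar> + \<bar>n\<bar>"
  define k where "k = nat (m + t)"
  define l where "l = nat (n + t)"
  have "m + t = int k" "n + t = int l"
    by (auto simp: k_def l_def t_def)
  then have k: "sK powi m * sK powi t = sK ^ k" and l: "sK powi n * sK powi t = sK ^ l"
    using power_int_add[of sK m t] power_int_add[of sK n t] by simp_all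
  have "qK ^ a * (sK powi m * sK powi t) = qK ^ b * (sK powi n * sK powi t)"
    using arg_cong[OF assms, of "\<lambda>x. x * sK powi t"] by (simp only: mult.assoc)
  then have "qK ^ a * sK ^ k = qK ^ b * sK ^ l"
    by (simp only: k l)
  then have "monom (monom (1::complex) k) a = monom (monom 1 l) b"
    by (simp add: qK_sK_power eq_fract)
  then have *: "a = b \<and> monom (1::complex) k = monom 1 l"
    by (metis monom_eq_iff' monom_eq_0_iff zero_neq_one)
  then have "k = l"
    by (metis monom_eq_iff' zero_neq_one)
  then show "a = b" "m = n"
    using * by (auto simp: k_def l_def t_def)
qed

text \<open>This keeps every denominator \<open>1 - sK powi m\<close> with
  \<open>m \<noteq> 0\<close> from vanishing.\<close>

lemma sK_powi_eq_1_iff [simp]: "sK powi m = 1 \<longleftrightarrow> m = 0"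
  using qK_sK_independent(2)[of 0 m 0 0] by auto

text \<open>With \<open>y = s ^ (m - 1)\<close> the left side is \<open>coef_b m\<close> and the
  fraction on the right is \<open>coef_a m\<close>. The product of the off-diagonal entries is minus
  \<open>(X + 1) * (X - s)\<close> at a diagonal entry, as a 2x2 block with eigenvalues
  \<open>s\<close> and \<open>-1\<close> requires.\<close>

lemma seminormal_coef_identity:
  fixes s y :: "'a::field"
  assumes "1 - s * y \<noteq> 0"
  shows "s * (1 - s * (s * y)) * (1 - y) / (1 - s * y)\<^sup>2
    = (s - (s - 1) / (1 - s * y)) * ((s - 1) / (1 - s * y) + 1)"
proof -
  have "s - (s - 1) / (1 - s * y) = (1 - s * (s * y)) / (1 - s * y)"
    "(s - 1) / (1 - s * y) + 1 = s * (1 - y) / (1 - s * y)"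
    using assms by (simp_all add: field_simps)
  then show ?thesis
    by (simp only: times_divide_times_eq power2_eq_square) (simp add: mult_ac)
qed

section \<open>Adjacent transpositions and the coefficients of the seminormal form\<close>

lemma adjswap_adjswap [simp]: "adjswap j (adjswap j k) = k"
  by (simp add: adjswap_def)

lemma adjswap_comp_adjswap [simp]: "adjswap j \<circ> adjswap j = id"
  by (simp add: fun_eq_iff)

lemma adjswap_simps [simp]:
  "adjswap j j = Suc j" "adjswap j (Suc j) = j"
  "k \<noteq> j \<Longrightarrow> k \<noteq> Suc j \<Longrightarrow> adjswap j k = k"
  by (simp_all add: adjswap_def)

lemma adjswap_conv_transpose: "adjswap j = transpose j (Suc j)"
  by (simp add: fun_eq_iff adjswap_def transpose_def)

lemma adjswap_permutes: "j \<in> {1..<N} \<Longrightarrow> adjswap j permutes {1..N}"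
  by (simp add: adjswap_conv_transpose permutes_swap_id)

lemma CT_tswap [simp]: "CT (tswap T i) j = CT T (adjswap i j)"
  by (simp add: CT_def row_def col_def tswap_def)

lemma tswap_tswap [simp]: "tswap (tswap T i) i = T"
  by (simp add: tswap_def o_assoc [symmetric])

text \<open>In terms of the axial distance \<open>m = CT T (Suc i) - CT T i\<close> the four cases of
  the action of a generator become one formula: \<open>diag_coef (-1)\<close> and \<open>diag_coef 1\<close> are the
  eigenvalues for a common row or column, where moreover \<open>off_coef\<close> vanishes.\<close>

definition diag_coef :: "int \<Rightarrow> K" where
  "diag_coef m = (sK - 1) / (1 - sK powi m)"

definition off_coef :: "int \<Rightarrow> K" where
  "off_coef m = (if m < 0 then coef_b (nat (- m)) else if 2 \<le> m then 1 else 0)"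

lemma coef_a_eq: "coef_a m = diag_coef (int m)"
  by (simp add: coef_a_def diag_coef_def)

lemma sK_neq_1 [simp]: "sK \<noteq> 1"
  using sK_powi_eq_1_iff[of 1] by simp

lemma diag_coef_pm1 [simp]: "diag_coef 1 = - 1" "diag_coef (- 1) = sK"
proof -
  have "1 - sK \<noteq> 0" "sK - 1 \<noteq> 0" by simp_all
  then show "diag_coef 1 = - 1" "diag_coef (- 1) = sK"
    by (simp_all add: diag_coef_def power_int_minus divide_simps)
qed

text \<open>The two diagonal entries of the block on \<open>T\<close> and \<open>tswap T i\<close>
  add up to the trace \<open>sK - 1\<close>.\<close>

lemma diag_coef_minus: "m \<noteq> 0 \<Longrightarrow> diag_coef (- m) = sK - 1 - diag_coef m"
proof -
  assume "m \<noteq> 0"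
  then have "sK powi m \<noteq> 1" "sK powi m \<noteq> 0" by simp_all
  then show ?thesis
    unfolding diag_coef_def power_int_minus
    by (simp add: divide_simps) (simp add: algebra_simps)
qed

lemma off_coef_pm1 [simp]: "off_coef 1 = 0" "off_coef (- 1) = 0"
  by (simp_all add: off_coef_def coef_b_def)

text \<open>This is the determinant condition of the block. It is symmetric in \<open>m\<close> and
  \<open>- m\<close>, because \<open>diag_coef_minus\<close> exchanges the two factors on the right,
  so only positive \<open>m\<close> needs a computation.\<close>

lemma off_coef_prod:
  assumes "m \<noteq> 0"
  shows "off_coef m * off_coef (- m) = (sK - diag_coef m) * (diag_coef m + 1)"
proof -
  have pos: "off_coef m * off_coef (- m) = (sK - diag_coef m) * (diag_coef m + 1)" if "m > 0" for m
  proof -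
    define k where "k = nat m - 1"
    have m: "m = int (Suc k)" using that by (simp add: k_def)
    have nz: "1 - sK ^ Suc k \<noteq> 0"
      using sK_powi_eq_1_iff[of "int (Suc k)"] by (simp del: power_Suc of_nat_Suc sK_powi_eq_1_iff)
    have a: "diag_coef m = (sK - 1) / (1 - sK ^ Suc k)"
      by (simp add: diag_coef_def m flip: power_int_of_nat)
    \<comment> \<open>For \<open>k = 0\<close>, that is at axial distance 1, both sides are zero;
      otherwise \<open>off_coef m\<close> is 1.\<close>
    have b: "off_coef m * off_coef (- m) = coef_b (Suc k)"
      by (cases "k = 0") (auto simp: off_coef_def m coef_b_def nat_add_distrib)
    show ?thesis
      unfolding b a coef_b_def using seminormal_coef_identity[of sK "sK ^ k"] nz
      by (simp add: mult.assoc)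
  qed
  show ?thesis
  proof (cases "m > 0")
    case False
    then show ?thesis
      using assms pos[of "- m"] diag_coef_minus[of m] by (simp add: mult.commute)
  qed (use pos in simp)
qed

lemma diag_coef_eq: "m \<noteq> 0 \<Longrightarrow> (1 - sK powi m) * diag_coef m = sK - 1"
  by (simp add: diag_coef_def)

text \<open>An addition law coming from \<open>sK powi (m + n) = sK powi m * sK powi n\<close>. It
  is the relation between three axial distances on which the braid relation rests.\<close>

lemma diag_coef_add:
  assumes "m \<noteq> 0" "n \<noteq> 0" "m + n \<noteq> 0"
  shows "diag_coef m * diag_coef n = (diag_coef m + diag_coef n - (sK - 1)) * diag_coef (m + n)"
proof -
  define p r A B C where "p = sK powi m" and "r = sK powi n"
    and "A = diag_coef m" and "B = diag_coef n" and "C = diag_coef (m + n)"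
  have "(1 - p) * A = sK - 1" "(1 - r) * B = sK - 1" and C: "(1 - p * r) * C = sK - 1"
    using assms diag_coef_eq[of m] diag_coef_eq[of n] diag_coef_eq[of "m + n"]
    by (simp_all add: p_def r_def A_def B_def C_def power_int_add)
  then have pr: "p * A = A - (sK - 1)" "r * B = B - (sK - 1)"
    by (simp_all add: algebra_simps)
  \<comment> \<open>Writing \<open>sK - 1\<close> as \<open>(1 - p * r) * C\<close> lets
    \<open>p\<close> and \<open>r\<close> be absorbed into \<open>A\<close> and \<open>B\<close>, so
    that no denominator has to be cleared.\<close>
  have "(sK - 1) * (A * B) = C * (A * B - (p * A) * (r * B))"
    unfolding C[symmetric] by (simp add: algebra_simps)
  also have "\<dots> = (sK - 1) * ((A + B - (sK - 1)) * C)"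
    unfolding pr by (simp add: algebra_simps)
  finally show ?thesis
    by (simp add: A_def B_def C_def)
qed

section \<open>Reverse standard tableaux and the seminormal module\<close>

locale shape =
  fixes N :: nat and lam :: "nat list"
  assumes partition: "is_partition N lam"
begin

abbreviation "Tabs \<equiv> Tab N lam"

lemma cells_mono:
  assumes "(r', c') \<in> cells lam" "1 \<le> r" "r \<le> r'" "1 \<le> c" "c \<le> c'"
  shows "(r, c) \<in> cells lam"
proof -
  have "lam ! (r' - 1) \<le> lam ! (r - 1)"
    using partition assms
    by (cases "r = r'") (auto simp: is_partition_def sorted_wrt_iff_nth_less cells_def)
  then show ?thesis
    using assms by (auto simp: cells_def)
qed

lemma Tab_bij: "T \<in> Tabs \<Longrightarrow> bij_betw T {1..N} (cells lam)"
  by (simp add: Tab_def)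

lemma Tab_outside: "T \<in> Tabs \<Longrightarrow> i \<notin> {1..N} \<Longrightarrow> T i = (0, 0)"
  by (simp add: Tab_def)

lemma Tab_cell: "T \<in> Tabs \<Longrightarrow> i \<in> {1..N} \<Longrightarrow> T i \<in> cells lam"
  using Tab_bij bij_betwE by blast

lemma Tab_entry:
  assumes "T \<in> Tabs" "p \<in> cells lam"
  obtains i where "i \<in> {1..N}" "T i = p"
  using bij_betw_imp_surj_on[OF Tab_bij[OF assms(1)]] assms(2) that
  by (metis imageE)

lemma Tab_inj: "T \<in> Tabs \<Longrightarrow> i \<in> {1..N} \<Longrightarrow> j \<in> {1..N} \<Longrightarrow> T i = T j \<Longrightarrow> i = j"
  using bij_betw_imp_inj_on[OF Tab_bij] by (metis inj_onD)

lemma Tab_row: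
  "T \<in> Tabs \<Longrightarrow> i \<in> {1..N} \<Longrightarrow> j \<in> {1..N} \<Longrightarrow> fst (T i) = fst (T j) \<Longrightarrow> snd (T i) < snd (T j) \<Longrightarrow> j < i"
  unfolding Tab_def by blast

lemma Tab_col:
  "T \<in> Tabs \<Longrightarrow> i \<in> {1..N} \<Longrightarrow> j \<in> {1..N} \<Longrightarrow> snd (T i) = snd (T j) \<Longrightarrow> fst (T i) < fst (T j) \<Longrightarrow> j < i"
  unfolding Tab_def by blast

lemma finite_cells: "finite (cells lam)"
proof (rule finite_subset)
  show "cells lam \<subseteq> {1..length lam} \<times> {1..sum_list lam}"
  proof clarify
    fix r c assume "(r, c) \<in> cells lam"
    then have rc: "r \<in> {1..length lam}" "1 \<le> c" "c \<le> lam ! (r - 1)"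
      by (auto simp: cells_def)
    then have "lam ! (r - 1) \<in> set lam" by (intro nth_mem) auto
    then have "lam ! (r - 1) \<le> sum_list lam" by (intro member_le_sum_list) simp_all
    with rc show "r \<in> {1..length lam} \<and> c \<in> {1..sum_list lam}" by auto
  qed
qed simp

lemma finite_Tab [simp]: "finite Tabs"
proof (rule finite_subset)
  show "Tabs \<subseteq> {f. \<forall>i. (i \<in> {1..N} \<longrightarrow> f i \<in> cells lam) \<and> (i \<notin> {1..N} \<longrightarrow> f i = (0, 0))}"
    using Tab_cell Tab_outside by blast
  show "finite {f. \<forall>i. (i \<in> {1..N} \<longrightarrow> f i \<in> cells lam) \<and> (i \<notin> {1..N} \<longrightarrow> f i = (0, 0))}"
    by (rule finite_set_of_finite_funs[OF _ finite_cells]) simp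
qed

text \<open>The corner cell in the row of \<open>i\<close> and the column of \<open>j\<close> lies
  in the diagram. Entries decrease along the row to it and then along the column to
  \<open>j\<close>.\<close>

lemma Tab_antimono:
  assumes T: "T \<in> Tabs" and ij: "i \<in> {1..N}" "j \<in> {1..N}"
    and "row T i \<le> row T j" "col T i \<le> col T j" "i \<noteq> j"
  shows "j < i"
proof -
  obtain r c r' c' where rc: "T i = (r, c)" "T j = (r', c')"
    by (metis surj_pair)
  have le: "r \<le> r'" "c \<le> c'" and ne: "(r, c) \<noteq> (r', c')"
    using assms rc Tab_inj[OF T ij] by (auto simp: row_def col_def)
  have "1 \<le> r" "1 \<le> c" "(r', c') \<in> cells lam"
    using Tab_cell[OF T ij(1)] Tab_cell[OF T ij(2)] rc by (auto simp: cells_def)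
  then have "(r, c') \<in> cells lam"
    using cells_mono le by (meson order_refl order_trans)
  then obtain k where k: "k \<in> {1..N}" "T k = (r, c')"
    using Tab_entry[OF T] by blast
  have "k \<le> i"
    using k rc le Tab_inj[OF T ij(1) k(1)]
    by (cases "c = c'") (use Tab_row[OF T ij(1) k(1)] in auto)
  moreover have "j \<le> k"
    using k rc le Tab_inj[OF T ij(2) k(1)]
    by (cases "r = r'") (use Tab_col[OF T k(1) ij(2)] in auto)
  ultimately show ?thesis
    using \<open>i \<noteq> j\<close> by simp
qed

text \<open>Applied to entries one or two apart, this leaves too few numbers to fill the rectangle
  spanned by their cells.\<close>

lemma Tab_between:
  assumes T: "T \<in> Tabs" and ij: "i \<in> {1..N}" "j \<in> {1..N}"
    and "row T i \<le> r" "r \<le> row T j" "col T i \<le> c" "c \<le> col T j" "(r, c) \<noteq> T i" "(r, c) \<noteq> T j"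
  obtains k where "k \<in> {1..N}" "T k = (r, c)" "j < k" "k < i"
proof -
  have "1 \<le> row T i" "1 \<le> col T i" "(row T j, col T j) \<in> cells lam"
    using Tab_cell[OF T ij(1)] Tab_cell[OF T ij(2)] by (auto simp: cells_def row_def col_def)
  then have "(r, c) \<in> cells lam"
    using cells_mono assms by (meson order_trans)
  then obtain k where k: "k \<in> {1..N}" "T k = (r, c)"
    using Tab_entry[OF T] by blast
  have "k \<noteq> i" "k \<noteq> j" using assms k by auto
  then have "k < i" "j < k"
    using Tab_antimono[OF T ij(1) k(1)] Tab_antimono[OF T k(1) ij(2)] assms k
    by (auto simp: row_def col_def)
  with k that show thesis by blast
qed

text \<open>Entries decrease away from the corner cell \<open>(1, 1)\<close>, so the largest one
  sits there. This is the base case of the Jucys-Murphy induction.\<close>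

lemma CT_N: "T \<in> Tabs \<Longrightarrow> 1 \<le> N \<Longrightarrow> CT T N = 0"
proof -
  assume T: "T \<in> Tabs" and "1 \<le> N"
  then have N: "N \<in> {1..N}" by simp
  have c: "T N \<in> cells lam" using Tab_cell[OF T N] .
  then have "(1, 1) \<in> cells lam"
    using cells_mono[of "fst (T N)" "snd (T N)" 1 1] by (auto simp: cells_def)
  then obtain k where k: "k \<in> {1..N}" "T k = (1, 1)"
    using Tab_entry[OF T] by blast
  have "k = N"
    using Tab_antimono[OF T k(1) N] c k by (cases "k = N") (auto simp: row_def col_def cells_def)
  then show ?thesis using k by (simp add: CT_def row_def col_def)
qed

text \<open>Entries are compared from the largest down. If \<open>k\<close> stood in different cells
  of one diagonal, the cell nearer the corner would in the other tableau hold a larger entry, and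
  larger entries are already known to be placed alike.\<close>

lemma Tab_eqI:
  assumes T: "T \<in> Tabs" "T' \<in> Tabs" and CT: "\<And>k. k \<in> {1..N} \<Longrightarrow> CT T k = CT T' k"
  shows "T = T'"
proof -
  have "k \<in> {1..N} \<Longrightarrow> T k = T' k" for k
  proof (induction "N - k" arbitrary: k rule: less_induct)
    case less
    have IH: "T j = T' j" if "j \<in> {1..N}" "k < j" for j
      using less.hyps[of j] less.prems that by auto
    have aux: False
      if S: "S \<in> Tabs" "S' \<in> Tabs" and eq: "\<And>j. j \<in> {1..N} \<Longrightarrow> k < j \<Longrightarrow> S j = S' j"
        and lt: "row S k < row S' k" and ct: "CT S k = CT S' k" for S S'
    proof -
      obtain j where j: "j \<in> {1..N}" "S' j = S k"
        using Tab_entry[OF S(2) Tab_cell[OF S(1) less.prems]] by blast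
      have "j \<noteq> k" using j lt by (auto simp: row_def)
      then have "k < j"
        using Tab_antimono[OF S(2) j(1) less.prems] j lt ct by (auto simp: row_def col_def CT_def)
      then show False
        using eq[OF j(1)] j Tab_inj[OF S(1) j(1) less.prems] by auto
    qed
    have "\<not> row T k < row T' k"
      using aux[OF T] IH CT less.prems by blast
    moreover have "\<not> row T' k < row T k"
      using aux[OF T(2,1)] IH CT[OF less.prems] by (metis)
    ultimately show ?case
      using CT[OF less.prems] by (auto simp: row_def col_def CT_def prod_eq_iff)
  qed
  moreover have "T k = T' k" if "k \<notin> {1..N}" for k
    using Tab_outside[OF T(1) that] Tab_outside[OF T(2) that] by simp
  ultimately show ?thesis by blast
qed

text \<open>No number lies strictly between \<open>i\<close> and \<open>Suc i\<close>. Hence, when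
  the cell of \<open>Suc i\<close> is weakly below and weakly left of that of \<open>i\<close>, the
  spanned rectangle has no further cell: the two are neighbours in a row or column, and a strict
  shift in both directions is impossible.\<close>

lemma Tab_adjacent_cases [consumes 2, case_names same_row same_col higher lower]:
  assumes T: "T \<in> Tabs" and i: "i \<in> {1..<N}"
  obtains
    "row T i = row T (Suc i)" "CT T (Suc i) - CT T i = -1"
  | "row T i \<noteq> row T (Suc i)" "col T i = col T (Suc i)" "CT T (Suc i) - CT T i = 1"
  | "row T (Suc i) < row T i" "col T i < col T (Suc i)"
  | "row T i < row T (Suc i)" "col T (Suc i) < col T i"
proof -
  have ij: "i \<in> {1..N}" "Suc i \<in> {1..N}" using i by auto
  note b = Tab_between[OF T ij(2,1)]
  have no_le: "\<not> (row T i \<le> row T (Suc i) \<and> col T i \<le> col T (Suc i))"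
    using Tab_antimono[OF T ij] by auto
  have none: "(r, c) = T (Suc i) \<or> (r, c) = T i"
    if "row T (Suc i) \<le> r" "r \<le> row T i" "col T (Suc i) \<le> c" "c \<le> col T i" for r c
    using b[of r c] that by (metis Suc_leI linorder_not_less)
  consider "row T i = row T (Suc i)" | "row T i \<noteq> row T (Suc i)" "col T i = col T (Suc i)"
    | "row T (Suc i) < row T i" "col T i < col T (Suc i)"
    | "row T i < row T (Suc i)" "col T (Suc i) < col T i"
    | "row T (Suc i) < row T i" "col T (Suc i) < col T i"
    using no_le by linarith
  then show thesis
  proof cases
    case 1
    then have lt: "col T (Suc i) < col T i" using no_le by auto
    then have "col T i = Suc (col T (Suc i))"
      using none[of "row T i" "Suc (col T (Suc i))"] 1 by (auto simp: row_def col_def prod_eq_iff)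
    then show ?thesis using that(1) 1 by (simp add: CT_def)
  next
    case 2
    then have lt: "row T (Suc i) < row T i" using no_le by auto
    then have "row T i = Suc (row T (Suc i))"
      using none[of "Suc (row T (Suc i))" "col T i"] 2 by (auto simp: row_def col_def prod_eq_iff)
    then show ?thesis using that(2) 2 by (simp add: CT_def)
  next
    case 5
    then show ?thesis
      using none[of "row T i" "col T (Suc i)"] by (auto simp: row_def col_def prod_eq_iff)
  qed (use that in auto)
qed

lemma CT_adjacent_neq:
  assumes "T \<in> Tabs" "i \<in> {1..<N}"
  shows "CT T i \<noteq> CT T (Suc i)"
  using assms by (cases rule: Tab_adjacent_cases) (auto simp: CT_def)

text \<open>Two cells on a common diagonal span a square, so at least two entries lie between theirs.\<close>
lemma CT_distance2_neq:
  assumes T: "T \<in> Tabs" and i: "1 \<le> i" "Suc i < N"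
  shows "CT T i \<noteq> CT T (Suc (Suc i))"
proof
  assume eq: "CT T i = CT T (Suc (Suc i))"
  have ij: "i \<in> {1..N}" "Suc (Suc i) \<in> {1..N}" using i by auto
  have "\<not> (row T i \<le> row T (Suc (Suc i)) \<and> col T i \<le> col T (Suc (Suc i)))"
    using Tab_antimono[OF T ij] by auto
  then have lt: "row T (Suc (Suc i)) < row T i" "col T (Suc (Suc i)) < col T i"
    using eq by (auto simp: CT_def)
  have aux: "T (Suc i) = (r, c)"
    if h: "row T (Suc (Suc i)) \<le> r" "r \<le> row T i" "col T (Suc (Suc i)) \<le> c" "c \<le> col T i"
      "(r, c) \<noteq> T (Suc (Suc i))" "(r, c) \<noteq> T i" for r c
  proof (rule Tab_between[OF T ij(2,1) h])
    fix k assume "T k = (r, c)" "i < k" "k < Suc (Suc i)"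
    then show ?thesis by (metis Suc_leI antisym less_Suc_eq_le)
  qed
  have "T (Suc i) = (row T i, col T (Suc (Suc i)))" "T (Suc i) = (row T (Suc (Suc i)), col T i)"
    using lt by (intro aux; auto simp: row_def col_def prod_eq_iff)+
  then show False using lt by simp
qed

text \<open>Exchanging consecutive numbers alters only the comparison between these two, which
  matters only in a common row or column.\<close>

lemma tswap_in_Tab:
  assumes T: "T \<in> Tabs" and i: "i \<in> {1..<N}"
    and ne: "row T i \<noteq> row T (Suc i)" "col T i \<noteq> col T (Suc i)"
  shows "tswap T i \<in> Tabs"
proof -
  have P: "adjswap i permutes {1..N}" using adjswap_permutes i by blast
  have bij: "bij_betw (tswap T i) {1..N} (cells lam)"
    unfolding tswap_def using bij_betw_trans[OF permutes_imp_bij[OF P] Tab_bij[OF T]] .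
  have out: "tswap T i k = (0, 0)" if "k \<notin> {1..N}" for k
    using Tab_outside[OF T that] permutes_not_in[OF P that] by (simp add: tswap_def)
  have key: "b < a" if "a \<in> {1..N}" "b \<in> {1..N}" "adjswap i b < adjswap i a"
    "row T (adjswap i a) = row T (adjswap i b) \<or> col T (adjswap i a) = col T (adjswap i b)" for a b
    using that ne by (auto simp: adjswap_def split: if_splits)
  have mem: "adjswap i a \<in> {1..N}" if "a \<in> {1..N}" for a
    using permutes_in_image[OF P] that by simp
  show ?thesis
    unfolding Tab_def
  proof (intro CollectI conjI ballI impI)
    fix a b assume ab: "a \<in> {1..N}" "b \<in> {1..N}"
    { assume "fst (tswap T i a) = fst (tswap T i b) \<and> snd (tswap T i a) < snd (tswap T i b)"
      then show "b < a"
        using Tab_row[OF T mem[OF ab(1)] mem[OF ab(2)]] key[OF ab] by (simp add: tswap_def row_def) }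
    { assume "snd (tswap T i a) = snd (tswap T i b) \<and> fst (tswap T i a) < fst (tswap T i b)"
      then show "b < a"
        using Tab_col[OF T mem[OF ab(1)] mem[OF ab(2)]] key[OF ab] by (simp add: tswap_def col_def) }
  qed (use bij out in auto)
qed

text \<open>The condition \<open>T = tswap T' i\<close> singles out the source tableau, so that the
  sum over sources in \<open>vTi\<close> collapses.\<close>

lemma tabTi_eq:
  assumes T: "T \<in> Tabs" and i: "i \<in> {1..<N}"
  shows "tabTi i T T' = diag_coef (CT T (Suc i) - CT T i) * (if T = T' then 1 else 0)
    + off_coef (CT T i - CT T (Suc i)) * (if T = tswap T' i then 1 else 0)"
proof -
  have b: "basis (tswap T i) T' = (if T = tswap T' i then 1 else 0)"
    by (metis basis_def tswap_tswap)
  show ?thesis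
    using T i
  proof (cases rule: Tab_adjacent_cases)
    case same_row
    have *: "CT T i - CT T (Suc i) = 1" using same_row by simp
    show ?thesis
      unfolding * same_row(2) using same_row by (auto simp: tabTi_def basis_def)
  next
    case same_col
    have *: "CT T i - CT T (Suc i) = - 1" using same_col by simp
    show ?thesis
      unfolding * same_col(3) using same_col by (auto simp: tabTi_def basis_def)
  next
    case higher
    then have "CT T (Suc i) - CT T i > 0" by (simp add: CT_def)
    then show ?thesis
      using higher by (simp add: tabTi_def Let_def b coef_a_eq off_coef_def) (simp add: basis_def)
  next
    case lower
    then have *: "CT T i - CT T (Suc i) \<ge> 2" by (simp add: CT_def)
    then have "diag_coef (CT T (Suc i) - CT T i) = sK - 1 - diag_coef (CT T i - CT T (Suc i))"
      using diag_coef_minus[of "CT T i - CT T (Suc i)"] by simp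
    then show ?thesis
      using lower * by (simp add: tabTi_def Let_def b coef_a_eq off_coef_def) (simp add: basis_def)
  qed
qed

text \<open>A swap leaves the standard tableaux only when the cells share a row or column, that is
  at axial distance 1 or -1.\<close>

lemma off_coef_eq_0:
  assumes T: "T \<in> Tabs" and i: "i \<in> {1..<N}" and "tswap T i \<notin> Tabs"
  shows "off_coef (CT T (Suc i) - CT T i) = 0" "off_coef (CT T i - CT T (Suc i)) = 0"
proof -
  have same: "row T i = row T (Suc i) \<or> col T i = col T (Suc i)"
    using assms tswap_in_Tab by blast
  from T i have "CT T (Suc i) - CT T i = - 1 \<or> CT T (Suc i) - CT T i = 1"
    by (cases rule: Tab_adjacent_cases) (use same in auto)
  moreover have "CT T i - CT T (Suc i) = - (CT T (Suc i) - CT T i)" by simp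
  ultimately show "off_coef (CT T (Suc i) - CT T i) = 0" "off_coef (CT T i - CT T (Suc i)) = 0"
    by (metis off_coef_pm1 minus_minus)+
qed

text \<open>The action is read off by target tableau. The contribution of \<open>tswap T i\<close>
  carries the opposite axial distance, which is why \<open>off_coef\<close> takes the value
  \<open>coef_b\<close> at negative arguments.\<close>

lemma vTi_eq:
  assumes i: "i \<in> {1..<N}"
  shows "vTi N lam i u T = (if T \<in> Tabs then diag_coef (CT T (Suc i) - CT T i) * u T
    + off_coef (CT T (Suc i) - CT T i) * u (tswap T i) else 0)"
proof -
  have "vTi N lam i u T = (\<Sum>S\<in>Tabs. (if S = T then u S * diag_coef (CT S (Suc i) - CT S i) else 0)
     + (if S = tswap T i then u S * off_coef (CT S i - CT S (Suc i)) else 0))"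
    unfolding vTi_def by (rule sum.cong) (auto simp: tabTi_eq[OF _ i] algebra_simps simp del: CT_tswap)
  also have "\<dots> = (if T \<in> Tabs then u T * diag_coef (CT T (Suc i) - CT T i) else 0)
     + (if tswap T i \<in> Tabs then u (tswap T i) * off_coef (CT T (Suc i) - CT T i) else 0)"
    by (simp add: sum.distrib)
  finally show ?thesis
    using off_coef_eq_0[OF _ i, of T] off_coef_eq_0[OF _ i, of "tswap T i"]
    by (auto simp: algebra_simps)
qed


text \<open>Letting the generators act as the scalar \<open>sK\<close> off the standard tableaux extends the
  module to all coefficient functions, so that the Hecke relations hold without side conditions
  on supports.\<close>

definition hT :: "nat \<Rightarrow> vec \<Rightarrow> vec" where
  "hT i u = (\<lambda>T. if T \<in> Tabs then diag_coef (CT T (Suc i) - CT T i) * u T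
     + off_coef (CT T (Suc i) - CT T i) * u (tswap T i) else sK * u T)"

definition hTinv :: "nat \<Rightarrow> vec \<Rightarrow> vec" where
  "hTinv i u = (\<lambda>T. inverse sK * (hT i u T + (1 - sK) * u T))"

definition tab_supported :: "vec \<Rightarrow> bool" where
  "tab_supported u \<longleftrightarrow> (\<forall>T. T \<notin> Tabs \<longrightarrow> u T = 0)"

lemma vTi_eq_hT: "i \<in> {1..<N} \<Longrightarrow> tab_supported u \<Longrightarrow> vTi N lam i u = hT i u"
  by (auto simp: fun_eq_iff vTi_eq hT_def tab_supported_def)

lemma vTinv_eq_hTinv: "i \<in> {1..<N} \<Longrightarrow> tab_supported u \<Longrightarrow> vTinv N lam i u = hTinv i u"
  by (simp add: fun_eq_iff vTinv_def hTinv_def vTi_eq_hT)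

lemma tab_supported_hT: "tab_supported u \<Longrightarrow> tab_supported (hT i u)"
  by (simp add: tab_supported_def hT_def)

lemma tab_supported_hTinv: "tab_supported u \<Longrightarrow> tab_supported (hTinv i u)"
  by (simp add: tab_supported_def hTinv_def hT_def)

lemma hT_scale: "hT i (\<lambda>T. c * u T) = (\<lambda>T. c * hT i u T)"
  by (simp add: fun_eq_iff hT_def algebra_simps)

lemma hTinv_scale: "hTinv i (\<lambda>T. c * u T) = (\<lambda>T. c * hTinv i u T)"
  by (simp add: fun_eq_iff hTinv_def hT_scale algebra_simps)

lemma hT_add: "hT i (\<lambda>T. u T + w T) = (\<lambda>T. hT i u T + hT i w T)"
  by (simp add: fun_eq_iff hT_def algebra_simps)

lemma hT_tab: "T \<in> Tabs \<Longrightarrow> hT i u T = diag_coef (CT T (Suc i) - CT T i) * u T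
     + off_coef (CT T (Suc i) - CT T i) * u (tswap T i)"
  by (simp add: hT_def)

text \<open>The factor \<open>off_coef\<close> absorbs the test for standardness: if
  \<open>tswap T i\<close> is not standard, both sides vanish.\<close>

lemma off_coef_hT_tswap:
  assumes T: "T \<in> Tabs" and i: "i \<in> {1..<N}"
  shows "off_coef (CT T (Suc i) - CT T i) * hT j u (tswap T i)
    = off_coef (CT T (Suc i) - CT T i) *
      (diag_coef (CT T (adjswap i (Suc j)) - CT T (adjswap i j)) * u (tswap T i)
       + off_coef (CT T (adjswap i (Suc j)) - CT T (adjswap i j)) * u (tswap (tswap T i) j))"
  using off_coef_eq_0(1)[OF T i] by (cases "tswap T i \<in> Tabs") (simp_all add: hT_tab)

text \<open>This is the Cayley-Hamilton identity of the block on \<open>T\<close> and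
  \<open>tswap T i\<close>, with trace \<open>sK - 1\<close> and determinant \<open>- sK\<close>.
  Off the standard tableaux the scalar \<open>sK\<close> is a root of the same polynomial.\<close>

lemma hT_quadratic:
  assumes i: "i \<in> {1..<N}"
  shows "hT i (hT i u) = (\<lambda>T. (sK - 1) * hT i u T + sK * u T)"
proof
  fix T
  show "hT i (hT i u) T = (sK - 1) * hT i u T + sK * u T"
  proof (cases "T \<in> Tabs")
    case T: True
    define m where "m = CT T (Suc i) - CT T i"
    have m: "m \<noteq> 0" "CT T i - CT T (Suc i) = - m"
      using CT_adjacent_neq[OF T i] by (auto simp: m_def)
    have "hT i (hT i u) T = diag_coef m * (diag_coef m * u T + off_coef m * u (tswap T i))
        + off_coef m * (diag_coef (- m) * u (tswap T i) + off_coef (- m) * u T)"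
      using off_coef_hT_tswap[OF T i, of i u] T m by (simp add: hT_tab flip: m_def)
    also have "\<dots> = (diag_coef m * diag_coef m + off_coef m * off_coef (- m)) * u T
        + off_coef m * (diag_coef m + diag_coef (- m)) * u (tswap T i)"
      by (simp add: algebra_simps)
    also have "\<dots> = (diag_coef m * diag_coef m + (sK - diag_coef m) * (diag_coef m + 1)) * u T
        + off_coef m * (sK - 1) * u (tswap T i)"
      using m by (simp add: off_coef_prod diag_coef_minus)
    finally show ?thesis
      using T by (simp add: hT_tab algebra_simps flip: m_def)
  qed (simp add: hT_def algebra_simps)
qed

lemma hT_hTinv [simp]:
  assumes i: "i \<in> {1..<N}"
  shows "hT i (hTinv i u) = u"
proof -
  have "hT i (hTinv i u) = (\<lambda>T. inverse sK * (hT i (hT i u) T + (1 - sK) * hT i u T))"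
    unfolding hTinv_def by (simp only: hT_scale hT_add)
  also have "\<dots> = (\<lambda>T. inverse sK * (sK * u T))"
    by (simp add: hT_quadratic[OF i] algebra_simps)
  also have "\<dots> = u" by (simp flip: mult.assoc)
  finally show ?thesis .
qed

lemma hTinv_hT [simp]:
  assumes i: "i \<in> {1..<N}"
  shows "hTinv i (hT i u) = u"
proof -
  have "hTinv i (hT i u) = (\<lambda>T. inverse sK * (sK * u T))"
    unfolding hTinv_def by (simp add: hT_quadratic[OF i] algebra_simps)
  also have "\<dots> = u" by (simp flip: mult.assoc)
  finally show ?thesis .
qed

lemma hT_commute:
  assumes i: "i \<in> {1..<N}" and j: "j \<in> {1..<N}" and ij: "Suc i < j \<or> Suc j < i"
  shows "hT i (hT j u) = hT j (hT i u)"
proof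
  fix T
  show "hT i (hT j u) T = hT j (hT i u) T"
  proof (cases "T \<in> Tabs")
    case T: True
    have sw: "tswap (tswap T i) j = tswap (tswap T j) i"
      using ij by (auto simp: tswap_def fun_eq_iff adjswap_def)
    have *: "adjswap i j = j" "adjswap i (Suc j) = Suc j" "adjswap j i = i" "adjswap j (Suc i) = Suc i"
      using ij by (auto simp: adjswap_def)
    show ?thesis
      using off_coef_hT_tswap[OF T i, of j u] off_coef_hT_tswap[OF T j, of i u]
      by (simp only: hT_tab[OF T] * sw) (simp add: algebra_simps)
  qed (simp add: hT_def)
qed

text \<open>The seminormal formula without the test for standardness, so that products of generators
  expand freely.\<close>

definition thetaT :: "nat \<Rightarrow> vec \<Rightarrow> vec" where
  "thetaT i u = (\<lambda>T. diag_coef (CT T (Suc i) - CT T i) * u T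
     + off_coef (CT T (Suc i) - CT T i) * u (tswap T i))"

text \<open>Agreement on standard tableaux suffices, because a nonstandard swap enters with
  coefficient zero. Allowing two different functions makes the rule iterable through a
  product.\<close>

lemma hT_eq_thetaT:
  assumes "i \<in> {1..<N}" "\<And>T. T \<in> Tabs \<Longrightarrow> u T = u' T" "T \<in> Tabs"
  shows "hT i u T = thetaT i u' T"
  using assms off_coef_eq_0(1)[of T i]
  by (cases "tswap T i \<in> Tabs") (simp_all add: hT_def thetaT_def)

text \<open>Both sides are expanded over the six fillings obtained by permuting three consecutive
  entries. The coefficients of \<open>u0\<close>, \<open>u1\<close> and \<open>u2\<close> agree by
  the addition law and the block relations; the other three coincide at once.\<close>

lemma hT_braid:
  assumes i: "1 \<le> i" "Suc i < N"
  shows "hT i (hT (Suc i) (hT i u)) = hT (Suc i) (hT i (hT (Suc i) u))"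
proof
  fix T
  show "hT i (hT (Suc i) (hT i u)) T = hT (Suc i) (hT i (hT (Suc i) u)) T"
  proof (cases "T \<in> Tabs")
    case T: True
    have ij: "i \<in> {1..<N}" "Suc i \<in> {1..<N}" using i by auto
    define x y z where "x = CT T i" and "y = CT T (Suc i)" and "z = CT T (Suc (Suc i))"
    have ne: "y - x \<noteq> 0" "z - y \<noteq> 0" "z - x \<noteq> 0"
      using CT_adjacent_neq[OF T ij(1)] CT_adjacent_neq[OF T ij(2)] CT_distance2_neq[OF T i]
      by (auto simp: x_def y_def z_def)
    define a1 a2 a3 where a: "a1 = diag_coef (y - x)" "a2 = diag_coef (z - y)" "a3 = diag_coef (z - x)"
    define b1 b2 b3 where b: "b1 = off_coef (y - x)" "b2 = off_coef (z - y)" "b3 = off_coef (z - x)"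
    define a1' a2' b1' b2' where a': "a1' = diag_coef (x - y)" "a2' = diag_coef (y - z)"
      and b': "b1' = off_coef (x - y)" "b2' = off_coef (y - z)"
    have a'_eq: "a1' = sK - 1 - a1" "a2' = sK - 1 - a2"
      using diag_coef_minus[OF ne(1)] diag_coef_minus[OF ne(2)] by (simp_all add: a a')
    have bb: "b1 * b1' = (sK - a1) * (a1 + 1)" "b2 * b2' = (sK - a2) * (a2 + 1)"
      using off_coef_prod[OF ne(1)] off_coef_prod[OF ne(2)] by (simp_all add: a b b')
    have aa: "a1 * a2 = (a1 + a2 - (sK - 1)) * a3"
      using diag_coef_add[OF ne(1,2)] ne by (simp add: a)
    \<comment> \<open>The difference of the two coefficients of \<open>u0\<close> is a multiple of
      the defect in the addition law.\<close>
    have "a1 * a2 * a1 + b1 * b1' * a3 - (a2 * a1 * a2 + b2 * b2' * a3)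
        = (a1 - a2) * (a1 * a2 - (a1 + a2 - (sK - 1)) * a3)"
      unfolding bb by (simp add: algebra_simps)
    then have c0: "a1 * a2 * a1 + b1 * b1' * a3 = a2 * a1 * a2 + b2 * b2' * a3"
      using aa by simp
    have c1: "a1 * a2 + a3 * a1' = a2 * a3" and c2: "a2 * a1 + a3 * a2' = a1 * a3"
      using aa by (simp_all add: a'_eq algebra_simps)
    define u0 u1 u2 u12 u21 u121 where "u0 = u T" and "u1 = u (tswap T i)"
      and "u2 = u (tswap T (Suc i))" and "u12 = u (tswap (tswap T i) (Suc i))"
      and "u21 = u (tswap (tswap T (Suc i)) i)"
      and "u121 = u (tswap (tswap (tswap T i) (Suc i)) i)"
    note u = this
    have u212: "u121 = u (tswap (tswap (tswap T (Suc i)) i) (Suc i))"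
      unfolding u by (rule arg_cong[of _ _ u]) (auto simp: tswap_def fun_eq_iff adjswap_def)
    have "hT i (hT (Suc i) (hT i u)) T = thetaT i (thetaT (Suc i) (thetaT i u)) T"
      using T ij by (intro hT_eq_thetaT) auto
    also have "\<dots> = a1 * (a2 * (a1 * u0 + b1 * u1) + b2 * (a3 * u2 + b3 * u21))
        + b1 * (a3 * (a1' * u1 + b1' * u0) + b3 * (a2 * u12 + b2 * u121))"
      by (simp add: thetaT_def a b a' b' u x_def y_def z_def)
    also have "\<dots> = (a1 * a2 * a1 + b1 * b1' * a3) * u0 + b1 * (a1 * a2 + a3 * a1') * u1
        + a1 * a3 * b2 * u2 + a1 * b2 * b3 * u21 + a2 * b1 * b3 * u12 + b1 * b2 * b3 * u121"
      by (simp add: algebra_simps)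
    also have "\<dots> = (a2 * a1 * a2 + b2 * b2' * a3) * u0 + b1 * (a2 * a3) * u1
        + b2 * (a2 * a1 + a3 * a2') * u2 + a1 * b2 * b3 * u21 + a2 * b1 * b3 * u12 + b1 * b2 * b3 * u121"
      unfolding c0 c1 c2 by (simp add: algebra_simps)
    also have "\<dots> = a2 * (a1 * (a2 * u0 + b2 * u2) + b1 * (a3 * u1 + b3 * u12))
        + b2 * (a3 * (a2' * u2 + b2' * u0) + b3 * (a1 * u21 + b1 * u121))"
      by (simp add: algebra_simps)
    also have "\<dots> = thetaT (Suc i) (thetaT i (thetaT (Suc i) u)) T"
      unfolding u212 by (simp add: thetaT_def a b a' b' u x_def y_def z_def)
    also have "\<dots> = hT (Suc i) (hT i (hT (Suc i) u)) T"
      by (rule sym) (use T ij in \<open>intro hT_eq_thetaT; auto\<close>)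
    finally show ?thesis .
  qed (simp add: hT_def)
qed

text \<open>Writing \<open>J\<close> for the operator with index \<open>Suc k\<close>, the one with
  index \<open>k\<close> is \<open>hT k\<close> on both sides of \<open>J\<close>. By induction
  \<open>J\<close> is diagonal on each block; the outer generators cancel its off-diagonal part,
  since \<open>a * p + a' = 0\<close>, and leave a factor \<open>sK\<close> on the diagonal.\<close>

lemma jucys_murphy:
  assumes "1 \<le> k" "k \<le> N" "T \<in> Tabs"
  shows "foldl (\<lambda>u j. hT j u) (foldl (\<lambda>u j. hT j u) u [k..<N]) (rev [k..<N]) T
    = sK ^ (N - k) * sK powi CT T k * u T"
  using assms
proof (induction "N - k" arbitrary: k u T)
  case 0
  then show ?case using CT_N[of T] by auto
next
  case (Suc n)
  note T = \<open>T \<in> Tabs\<close>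
  have k: "k \<in> {1..<N}" using Suc by auto
  define J where "J u = foldl (\<lambda>u j. hT j u) (foldl (\<lambda>u j. hT j u) u [Suc k..<N]) (rev [Suc k..<N])" for u
  define c where "c = sK ^ (N - Suc k)"
  have J: "J u S = c * sK powi CT S (Suc k) * u S" if "S \<in> Tabs" for u S
    unfolding J_def c_def using Suc.hyps(1)[of "Suc k"] Suc.hyps(2) Suc.prems k that by auto
  define m a b a' b' where "m = CT T (Suc k) - CT T k" and "a = diag_coef m" and "b = off_coef m"
    and "a' = diag_coef (- m)" and "b' = off_coef (- m)"
  note d = this
  have m: "m \<noteq> 0" using CT_adjacent_neq[OF T k] by (simp add: d)
  have mm: "CT T k - CT T (Suc k) = - m" by (simp add: d)
  define p y where "p = sK powi m" and "y = sK powi CT T k"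
  have z: "sK powi CT T (Suc k) = y * p"
    by (simp add: p_def y_def d flip: power_int_add)
  have pa: "a * p = a - (sK - 1)"
    using diag_coef_eq[OF m] by (simp add: p_def a_def algebra_simps)
  have a': "a' = sK - 1 - a" and bb: "b * b' = (sK - a) * (a + 1)"
    using diag_coef_minus[OF m] off_coef_prod[OF m] by (simp_all add: d)
  have "[k..<N] = k # [Suc k..<N]" using k by (simp add: upt_conv_Cons)
  then have "foldl (\<lambda>u j. hT j u) (foldl (\<lambda>u j. hT j u) u [k..<N]) (rev [k..<N]) T
      = hT k (J (hT k u)) T"
    by (simp add: J_def)
  also have "\<dots> = a * J (hT k u) T + b * J (hT k u) (tswap T k)"
    using T by (simp add: hT_tab d)
  \<comment> \<open>In the swapped tableau \<open>Suc k\<close> has the content that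
    \<open>k\<close> has in \<open>T\<close>, so \<open>J\<close> contributes \<open>c * y\<close>
    here in place of \<open>c * y * p\<close>.\<close>
  also have "b * J (hT k u) (tswap T k) = b * (c * y * (a' * u (tswap T k) + b' * u T))"
  proof (cases "tswap T k \<in> Tabs")
    case True
    then show ?thesis by (simp add: J hT_tab y_def mm flip: a'_def b'_def)
  next
    case False
    then show ?thesis using off_coef_eq_0[OF T k] by (simp add: d)
  qed
  also have "a * J (hT k u) T = a * (c * (y * p) * (a * u T + b * u (tswap T k)))"
    using T by (simp add: J hT_tab z flip: m_def a_def b_def)
  also have "\<dots> + b * (c * y * (a' * u (tswap T k) + b' * u T))
      = c * y * ((a * p) * a + b * b') * u T + c * y * b * (a * p + a') * u (tswap T k)"
    by (simp add: algebra_simps)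
  also have "\<dots> = c * y * sK * u T"
    unfolding pa a' bb by (simp add: algebra_simps)
  also have "c * y * sK = sK ^ (N - k) * sK powi CT T k"
    using k by (simp add: c_def y_def Suc_diff_Suc[symmetric])
  finally show ?case .
qed

end

section \<open>Rank permutations and reduced words\<close>

text \<open>In this form \<open>rv N v i\<close> is visibly a rank: positions are ordered by
  decreasing entry, ties from left to right.\<close>

lemma rv_eq_card:
  assumes "i \<in> {1..N}"
  shows "rv N v i = card {j\<in>{1..N}. v i < v j \<or> v j = v i \<and> j \<le> i}"
proof -
  have "{j\<in>{1..N}. v i < v j \<or> v j = v i \<and> j \<le> i}
      = {j\<in>{1..i}. v i \<le> v j} \<union> {j\<in>{Suc i..N}. v i < v j}"
    using assms by auto
  moreover have "{j\<in>{1..i}. v i \<le> v j} \<inter> {j\<in>{Suc i..N}. v i < v j} = {}"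
    by auto
  ultimately show ?thesis
    using assms by (simp add: rv_def card_Un_disjoint)
qed

lemma rv_less:
  assumes "i \<in> {1..N}" "k \<in> {1..N}" "v i > v k \<or> v i = v k \<and> i < k"
  shows "rv N v i < rv N v k"
  unfolding rv_eq_card[OF assms(1)] rv_eq_card[OF assms(2)]
proof (rule psubset_card_mono)
  have "k \<in> {j\<in>{1..N}. v k < v j \<or> v j = v k \<and> j \<le> k}"
    "k \<notin> {j\<in>{1..N}. v i < v j \<or> v j = v i \<and> j \<le> i}"
    using assms by auto
  moreover have "{j\<in>{1..N}. v i < v j \<or> v j = v i \<and> j \<le> i} \<subseteq> {j\<in>{1..N}. v k < v j \<or> v j = v k \<and> j \<le> k}"
    using assms by auto
  ultimately show "{j\<in>{1..N}. v i < v j \<or> v j = v i \<and> j \<le> i} \<subset> {j\<in>{1..N}. v k < v j \<or> v j = v k \<and> j \<le> k}"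
    by blast
qed simp

lemma rv_descent_iff:
  assumes "j \<in> {1..<N}"
  shows "rv N v (Suc j) < rv N v j \<longleftrightarrow> v j < v (Suc j)"
proof -
  have "j \<in> {1..N}" "Suc j \<in> {1..N}" using assms by auto
  then show ?thesis
    using rv_less[of j N "Suc j" v] rv_less[of "Suc j" N j v] by force
qed

text \<open>The two exchanged entries differ, so positions with equal entries keep their relative
  order and the tie rule is respected.\<close>

lemma rv_adjswap:
  assumes j: "j \<in> {1..<N}" and lt: "v j < v (Suc j)"
  shows "rv N (v \<circ> adjswap j) i = rv N v (adjswap j i)"
proof (cases "i \<in> {1..N}")
  case True
  have P: "adjswap j permutes {1..N}" by (rule adjswap_permutes[OF j])
  have mem: "adjswap j k \<in> {1..N} \<longleftrightarrow> k \<in> {1..N}" for k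
    by (rule permutes_in_image[OF P])
  have image: "{k\<in>{1..N}. Q k} = adjswap j ` {k\<in>{1..N}. Q (adjswap j k)}" for Q
  proof (intro equalityI subsetI)
    fix x assume "x \<in> {k\<in>{1..N}. Q k}"
    then have "adjswap j x \<in> {k\<in>{1..N}. Q (adjswap j k)}"
      using mem by (simp del: atLeastAtMost_iff)
    then show "x \<in> adjswap j ` {k\<in>{1..N}. Q (adjswap j k)}"
      using adjswap_adjswap by (metis imageI)
  qed (use mem in \<open>auto simp del: atLeastAtMost_iff\<close>)
  have "v (adjswap j k) = v (adjswap j i) \<Longrightarrow> adjswap j k \<le> adjswap j i \<longleftrightarrow> k \<le> i" for k
    using lt by (auto simp: adjswap_def split: if_splits)
  then have "{k\<in>{1..N}. v (adjswap j i) < v k \<or> v k = v (adjswap j i) \<and> k \<le> adjswap j i}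
      = adjswap j ` {k\<in>{1..N}. v (adjswap j i) < v (adjswap j k) \<or> v (adjswap j k) = v (adjswap j i) \<and> k \<le> i}"
    unfolding image[of "\<lambda>k. v (adjswap j i) < v k \<or> v k = v (adjswap j i) \<and> k \<le> adjswap j i"]
    by (metis (no_types, lifting))
  moreover have "inj (adjswap j)" using permutes_inj[OF P] .
  ultimately show ?thesis
    using True mem[of i]
    by (simp add: rv_eq_card card_image[OF inj_on_subset[OF _ subset_UNIV]] del: atLeastAtMost_iff)
next
  case False
  then have "adjswap j i = i" using permutes_not_in[OF adjswap_permutes[OF j]] by blast
  with False show ?thesis unfolding rv_def by (simp del: atLeastAtMost_iff)
qed

lemma rv_decreasing:
  assumes "\<And>j. j \<in> {1..<N} \<Longrightarrow> v (Suc j) \<le> v j"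
  shows "rv N v = id" and "\<And>i k. i \<in> {1..N} \<Longrightarrow> k \<in> {1..N} \<Longrightarrow> i \<le> k \<Longrightarrow> v k \<le> v i"
proof -
  show mono: "v k \<le> v i" if "i \<in> {1..N}" "k \<in> {1..N}" "i \<le> k" for i k
    using that(3,1,2)
  proof (induction k rule: dec_induct)
    case (step n)
    then show ?case using assms[of n] by force
  qed simp
  show "rv N v = id"
  proof
    fix i
    show "rv N v i = id i"
    proof (cases "i \<in> {1..N}")
      case True
      have "v i < v j \<or> v j = v i \<and> j \<le> i \<longleftrightarrow> j \<le> i" if "j \<in> {1..N}" for j
        using mono[of j i] mono[of i j] that True by (cases "j \<le> i") auto
      then have "{j\<in>{1..N}. v i < v j \<or> v j = v i \<and> j \<le> i} = {1..i}"
        using True by (auto simp del: One_nat_def) (metis atLeastAtMost_iff order_trans)+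
      then show ?thesis using True by (simp add: rv_eq_card)
    qed (unfold rv_def, simp del: atLeastAtMost_iff)
  qed
qed

text \<open>The number of inversions is the Coxeter length: it bounds the length of any word from
  below and drops by one at each descent.\<close>

definition inversions :: "nat \<Rightarrow> (nat \<Rightarrow> nat) \<Rightarrow> (nat \<times> nat) set" where
  "inversions N \<sigma> = {(a, b). a \<in> {1..N} \<and> b \<in> {1..N} \<and> a < b \<and> \<sigma> b < \<sigma> a}"

lemma finite_inversions [simp]: "finite (inversions N \<sigma>)"
  by (rule finite_subset[of _ "{1..N} \<times> {1..N}"]) (auto simp: inversions_def)

text \<open>Relabelling both coordinates preserves the orientation of every pair except
  \<open>(j, Suc j)\<close>, which is therefore set aside.\<close>

lemma inversions_adjswap:
  assumes j: "j \<in> {1..<N}"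
  shows "inversions N (\<sigma> \<circ> adjswap j) - {(j, Suc j)}
    = map_prod (adjswap j) (adjswap j) ` (inversions N \<sigma> - {(j, Suc j)})"
proof -
  have P: "adjswap j permutes {1..N}" by (rule adjswap_permutes[OF j])
  have mem: "adjswap j k \<in> {1..N} \<longleftrightarrow> k \<in> {1..N}" for k
    by (rule permutes_in_image[OF P])
  have lt: "adjswap j a < adjswap j b" if "a < b" "(a, b) \<noteq> (j, Suc j)" for a b
    using that by (auto simp: adjswap_def)
  have ne: "(adjswap j a, adjswap j b) \<noteq> (j, Suc j)" if "a < b" for a b
    using that by (auto simp: adjswap_def split: if_splits)
  have sub: "map_prod (adjswap j) (adjswap j) ` (inversions N \<sigma> - {(j, Suc j)})
      \<subseteq> inversions N (\<sigma> \<circ> adjswap j) - {(j, Suc j)}" for \<sigma>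
    using lt ne mem by (auto simp: inversions_def simp del: atLeastAtMost_iff)
  show ?thesis
  proof
    show "inversions N (\<sigma> \<circ> adjswap j) - {(j, Suc j)}
      \<subseteq> map_prod (adjswap j) (adjswap j) ` (inversions N \<sigma> - {(j, Suc j)})"
    proof
      fix p assume "p \<in> inversions N (\<sigma> \<circ> adjswap j) - {(j, Suc j)}"
      \<comment> \<open>The reverse inclusion is \<open>sub\<close> for
        \<open>\<sigma> \<circ> adjswap j\<close>, because \<open>adjswap j\<close> is an
        involution.\<close>
      then have "map_prod (adjswap j) (adjswap j) p \<in> inversions N \<sigma> - {(j, Suc j)}"
        using sub[of "\<sigma> \<circ> adjswap j"] by (auto simp: o_assoc [symmetric])
      moreover have "p = map_prod (adjswap j) (adjswap j) (map_prod (adjswap j) (adjswap j) p)"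
        by (cases p) simp
      ultimately show "p \<in> map_prod (adjswap j) (adjswap j) ` (inversions N \<sigma> - {(j, Suc j)})"
        by blast
    qed
  qed (rule sub)
qed

lemma card_inversions_adjswap:
  assumes j: "j \<in> {1..<N}"
  shows "\<sigma> j < \<sigma> (Suc j) \<Longrightarrow> card (inversions N (\<sigma> \<circ> adjswap j)) = Suc (card (inversions N \<sigma>))"
    and "\<sigma> (Suc j) < \<sigma> j \<Longrightarrow> card (inversions N \<sigma>) = Suc (card (inversions N (\<sigma> \<circ> adjswap j)))"
    and "card (inversions N (\<sigma> \<circ> adjswap j)) \<le> Suc (card (inversions N \<sigma>))"
proof -
  have inj: "inj (map_prod (adjswap j) (adjswap j))"
    by (intro prod.inj_map permutes_inj[OF adjswap_permutes[OF j]])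
  have eq: "card (inversions N (\<sigma> \<circ> adjswap j) - {(j, Suc j)}) = card (inversions N \<sigma> - {(j, Suc j)})" for \<sigma>
    unfolding inversions_adjswap[OF j] by (rule card_image[OF inj_on_subset[OF inj subset_UNIV]])
  have mem: "(j, Suc j) \<in> inversions N \<sigma> \<longleftrightarrow> \<sigma> (Suc j) < \<sigma> j" for \<sigma>
    using j by (auto simp: inversions_def)
  have dec: "card (inversions N \<sigma>) = Suc (card (inversions N \<sigma> - {(j, Suc j)}))"
    if "\<sigma> (Suc j) < \<sigma> j" for \<sigma>
    using card.remove[of "inversions N \<sigma>" "(j, Suc j)"] that mem by simp
  have same: "inversions N \<sigma> - {(j, Suc j)} = inversions N \<sigma>" if "\<not> \<sigma> (Suc j) < \<sigma> j" for \<sigma>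
    using that mem by auto
  show *: "\<sigma> j < \<sigma> (Suc j) \<Longrightarrow> card (inversions N (\<sigma> \<circ> adjswap j)) = Suc (card (inversions N \<sigma>))"
    using dec[of "\<sigma> \<circ> adjswap j"] same[of \<sigma>] eq[of \<sigma>] by simp
  show **: "\<sigma> (Suc j) < \<sigma> j \<Longrightarrow> card (inversions N \<sigma>) = Suc (card (inversions N (\<sigma> \<circ> adjswap j)))"
    using dec[of \<sigma>] same[of "\<sigma> \<circ> adjswap j"] eq[of \<sigma>] by simp
  show "card (inversions N (\<sigma> \<circ> adjswap j)) \<le> Suc (card (inversions N \<sigma>))"
    using * ** same[of \<sigma>] same[of "\<sigma> \<circ> adjswap j"] eq[of \<sigma>]
    by (cases "\<sigma> j" "\<sigma> (Suc j)" rule: linorder_cases) auto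
qed

section \<open>Words in the adjacent transpositions\<close>

lemma word_perm_Nil [simp]: "word_perm [] = id"
  by (simp add: word_perm_def)

lemma word_perm_Cons [simp]: "word_perm (j # ws) = word_perm ws \<circ> adjswap j"
proof -
  have "foldl (\<lambda>f j. adjswap j \<circ> f) g ws = foldl (\<lambda>f j. adjswap j \<circ> f) id ws \<circ> g" for g
  proof (induction ws rule: rev_induct)
    case (snoc x xs)
    then show ?case by (simp add: o_assoc)
  qed simp
  then show ?thesis by (simp add: word_perm_def)
qed

lemma word_perm_permutes: "set ws \<subseteq> {1..<N} \<Longrightarrow> word_perm ws permutes {1..N}"
proof (induction ws)
  case (Cons j ws)
  then show ?case
    unfolding word_perm_Cons by (intro permutes_compose adjswap_permutes) auto
qed (simp add: permutes_id)

lemma card_inversions_word_perm: "set ws \<subseteq> {1..<N} \<Longrightarrow> card (inversions N (word_perm ws)) \<le> length ws"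
proof (induction ws)
  case Nil
  have "inversions N (word_perm []) = {}" by (auto simp: inversions_def)
  then show ?case by (simp only: card.empty)
next
  case (Cons j ws)
  then have "card (inversions N (word_perm ws)) \<le> length ws" "j \<in> {1..<N}" by auto
  then show ?case
    using card_inversions_adjswap(3)[of j N "word_perm ws"]
    unfolding word_perm_Cons list.size by linarith
qed

lemma rv_adjswap_comp:
  "j \<in> {1..<N} \<Longrightarrow> v j < v (Suc j) \<Longrightarrow> rv N (v \<circ> adjswap j) = rv N v \<circ> adjswap j"
  by (simp add: fun_eq_iff rv_adjswap)

text \<open>Bubble sort: exchanging an ascent of \<open>v\<close> removes exactly one inversion of
  \<open>rv N v\<close>, and for a decreasing vector the rank permutation is the identity.\<close>

lemma ex_short_word_rv:
  "\<exists>ws. set ws \<subseteq> {1..<N} \<and> word_perm ws = rv N v \<and> length ws = card (inversions N (rv N v))"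
proof (induction "card (inversions N (rv N v))" arbitrary: v rule: less_induct)
  case less
  show ?case
  proof (cases "\<exists>j\<in>{1..<N}. v j < v (Suc j)")
    case True
    then obtain j where j: "j \<in> {1..<N}" "v j < v (Suc j)" by blast
    have card: "card (inversions N (rv N v)) = Suc (card (inversions N (rv N (v \<circ> adjswap j))))"
      using card_inversions_adjswap(2)[OF j(1), of "rv N v"] rv_descent_iff[OF j(1), of v] j
      by (simp add: rv_adjswap_comp)
    then obtain ws where "set ws \<subseteq> {1..<N}" "word_perm ws = rv N (v \<circ> adjswap j)"
      "length ws = card (inversions N (rv N (v \<circ> adjswap j)))"
      using less[of "v \<circ> adjswap j"] by auto
    then show ?thesis
      using j card by (intro exI[of _ "j # ws"]) (simp add: rv_adjswap_comp o_assoc [symmetric])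
  next
    case False
    then have "rv N v = id" by (intro rv_decreasing(1)) (auto simp: not_less)
    moreover from this have "inversions N (rv N v) = {}" by (auto simp: inversions_def)
    ultimately show ?thesis by (intro exI[of _ "[]"]) simp
  qed
qed

lemma reduced_word_rv_length:
  assumes "reduced_word N (rv N v) ws"
  shows "length ws = card (inversions N (rv N v))"
  using assms card_inversions_word_perm[of ws N] ex_short_word_rv[of N v]
  by (fastforce simp: reduced_word_def)

lemma ex_reduced_word_rv: "\<exists>ws. reduced_word N (rv N v) ws"
proof -
  obtain ws where "set ws \<subseteq> {1..<N}" "word_perm ws = rv N v" "length ws = card (inversions N (rv N v))"
    using ex_short_word_rv by blast
  then show ?thesis
    using card_inversions_word_perm unfolding reduced_word_def by (metis order_refl)
qed

section \<open>Actions of the Hecke algebra\<close>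

text \<open>Operators act on the right in the paper, so a product of generators is applied to a vector
  by folding from the left.\<close>

locale hecke_action =
  fixes N :: nat and T Ti :: "nat \<Rightarrow> 'a \<Rightarrow> 'a"
  assumes T_Ti [simp]: "j \<in> {1..<N} \<Longrightarrow> T j (Ti j u) = u"
    and Ti_T [simp]: "j \<in> {1..<N} \<Longrightarrow> Ti j (T j u) = u"
    and braid: "1 \<le> j \<Longrightarrow> Suc j < N \<Longrightarrow> T j (T (Suc j) (T j u)) = T (Suc j) (T j (T (Suc j) u))"
    and commute: "j \<in> {1..<N} \<Longrightarrow> k \<in> {1..<N} \<Longrightarrow> Suc j < k \<or> Suc k < j \<Longrightarrow> T j (T k u) = T k (T j u)"
begin

abbreviation prodT :: "nat list \<Rightarrow> 'a \<Rightarrow> 'a" where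
  "prodT ws u \<equiv> foldl (\<lambda>u j. T j u) u ws"

definition sgnT :: "bool \<Rightarrow> nat \<Rightarrow> 'a \<Rightarrow> 'a" where
  "sgnT b j = (if b then T j else Ti j)"

text \<open>The sign is attached to the index of the generator, since in the leading part of
  \<open>\<Xi>\<^sub>i\<close> it is decided by comparing the exponent belonging to that index with
  \<open>v i\<close>.\<close>

definition sgnprod :: "(nat \<Rightarrow> bool) \<Rightarrow> nat list \<Rightarrow> 'a \<Rightarrow> 'a" where
  "sgnprod f ws u = foldl (\<lambda>u j. sgnT (f j) j u) u ws"

lemma sgnprod_simps [simp]:
  "sgnprod f [] u = u"
  "sgnprod f (j # ws) u = sgnprod f ws (sgnT (f j) j u)"
  "sgnprod f (ws @ ws') u = sgnprod f ws' (sgnprod f ws u)"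
  by (simp_all add: sgnprod_def)

lemma sgnprod_cong: "(\<And>j. j \<in> set ws \<Longrightarrow> f j = g j) \<Longrightarrow> sgnprod f ws u = sgnprod g ws u"
  unfolding sgnprod_def by (rule foldl_cong) auto

lemma prodT_eq_sgnprod: "prodT ws u = sgnprod (\<lambda>_. True) ws u"
  by (simp add: sgnprod_def sgnT_def)

lemma commute_sgnT:
  assumes "j \<in> {1..<N}" "k \<in> {1..<N}" "Suc j < k \<or> Suc k < j"
  shows "T j (sgnT b k u) = sgnT b k (T j u)"
proof (cases b)
  case False
  have "T k (T j (Ti k u)) = T j u" using commute[of k j "Ti k u"] assms by auto
  then have "T j (Ti k u) = Ti k (T j u)" by (metis Ti_T assms(2))
  with False show ?thesis by (simp add: sgnT_def)
qed (use commute[OF assms] in \<open>simp add: sgnT_def\<close>)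

lemma commute_sgnprod:
  assumes "j \<in> {1..<N}" "\<And>k. k \<in> set ws \<Longrightarrow> k \<in> {1..<N} \<and> (Suc j < k \<or> Suc k < j)"
  shows "T j (sgnprod f ws u) = sgnprod f ws (T j u)"
  using assms(2) by (induction ws arbitrary: u) (simp_all add: commute_sgnT[OF assms(1)])

text \<open>The sign pattern \<open>e \<and> \<not> f\<close> is excluded because the identity fails for it.\<close>

lemma braid_sgnT_up:
  assumes j: "1 \<le> j" "Suc j < N" and "e \<longrightarrow> f"
  shows "sgnT e j (sgnT f (Suc j) (T j u)) = T (Suc j) (sgnT f j (sgnT e (Suc j) u))"
proof -
  have mem: "j \<in> {1..<N}" "Suc j \<in> {1..<N}" using j by auto
  note inv = T_Ti[OF mem(1)] T_Ti[OF mem(2)] Ti_T[OF mem(1)] Ti_T[OF mem(2)]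
  consider "e" "f" | "\<not> e" "f" | "\<not> e" "\<not> f" using assms by blast
  then show ?thesis
  proof cases
    case 2
    have "Ti j (T (Suc j) (T j (T (Suc j) (Ti (Suc j) u)))) = T (Suc j) (T j (Ti (Suc j) u))"
      using braid[OF j, of "Ti (Suc j) u"] by (metis inv(3))
    with 2 show ?thesis by (simp add: sgnT_def inv)
  next
    case 3
    define w where "w = Ti j (Ti (Suc j) u)"
    have "T j (T (Suc j) (T j w)) = T j u" unfolding w_def using inv by simp
    then have "T (Suc j) (T j (T (Suc j) w)) = T j u" using braid[OF j] by simp
    then have "Ti j (Ti (Suc j) (T j u)) = T (Suc j) w" by (metis inv(3,4))
    with 3 show ?thesis by (simp add: sgnT_def w_def)
  qed (simp add: sgnT_def braid[OF j])
qed

text \<open>Only the letters \<open>j\<close> and \<open>Suc j\<close> of the long product interact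
  with \<open>T (Suc j)\<close>; the braid relation carries it past them as \<open>T j\<close>, and
  the other letters commute.\<close>

lemma prodT_rotate:
  assumes j: "1 \<le> j" "Suc j < N"
  shows "prodT [1..<N] (T (Suc j) u) = T j (prodT [1..<N] u)"
proof -
  have mem: "j \<in> {1..<N}" "Suc j \<in> {1..<N}" using j by auto
  have "[1..<N] = [1..<j] @ [j..<N]"
    using j upt_add_eq_append[of 1 j "N - j"] by simp
  then have split: "[1..<N] = [1..<j] @ [j, Suc j] @ [Suc (Suc j)..<N]"
    using j by (simp add: upt_conv_Cons)
  show ?thesis
    unfolding prodT_eq_sgnprod split
    using commute_sgnprod[OF mem(2), of "[1..<j]"] commute_sgnprod[OF mem(1), of "[Suc (Suc j)..<N]"] j
    by (simp add: sgnT_def braid)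
qed

text \<open>The operator by which the leading part of \<open>\<Xi>\<^sub>i\<close> acts on the coefficient of \<open>x\<^sup>v\<close>, up to a
  power of \<open>q\<close> and of \<open>s\<close>.\<close>

definition lead :: "(nat \<Rightarrow> nat) \<Rightarrow> nat \<Rightarrow> 'a \<Rightarrow> 'a" where
  "lead v i u = sgnprod (\<lambda>k. v (Suc k) \<le> v i) (rev [i..<N])
     (prodT [1..<N] (sgnprod (\<lambda>j. v j < v i) (rev [1..<i]) u))"

text \<open>The unnormalised Jucys-Murphy element; on tableaux it differs from the one with
  eigenvalue \<open>sK powi CT S k\<close> by the factor \<open>sK ^ (N - k)\<close>.\<close>

definition jm :: "nat \<Rightarrow> 'a \<Rightarrow> 'a" where
  "jm k u = prodT (rev [k..<N]) (prodT [k..<N] u)"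

lemma prodT_prodTi_cancel:
  "i \<le> N \<Longrightarrow> prodT [1..<i] (sgnprod (\<lambda>_. False) (rev [1..<i]) u) = u"
proof (induction i arbitrary: u)
  case (Suc i)
  show ?case
  proof (cases "i = 0")
    case False
    with Suc show ?thesis by (simp add: sgnT_def)
  qed simp
qed simp

text \<open>For decreasing exponents the letters below \<open>i\<close> all occur as inverses and
  cancel the first \<open>i - 1\<close> letters of the long product, while the letters from
  \<open>i\<close> on all occur with positive sign.\<close>

lemma lead_decreasing:
  assumes dec: "\<And>j. j \<in> {1..<N} \<Longrightarrow> v (Suc j) \<le> v j" and i: "i \<in> {1..N}"
  shows "lead v i u = jm i u"
proof -
  note mono = rv_decreasing(2)[of N v, OF dec]
  have "sgnprod (\<lambda>j. v j < v i) (rev [1..<i]) u = sgnprod (\<lambda>_. False) (rev [1..<i]) u"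
    using mono i by (intro sgnprod_cong) (force simp: not_less)
  moreover have "sgnprod (\<lambda>k. v (Suc k) \<le> v i) (rev [i..<N]) w = prodT (rev [i..<N]) w" for w
    unfolding prodT_eq_sgnprod using mono i by (intro sgnprod_cong) force
  moreover have "[1..<N] = [1..<i] @ [i..<N]"
    using i upt_add_eq_append[of 1 i "N - i"] by simp
  ultimately show ?thesis
    using i prodT_prodTi_cancel[of i u] by (simp add: lead_def jm_def)
qed

text \<open>One step of the conjugation by \<open>R_v\<close>. The strict ascent fixes the signs at
  the letters involved and rules out the pattern for which the signed braid relation fails.\<close>

lemma lead_adjswap:
  assumes j: "j \<in> {1..<N}" and lt: "v j < v (Suc j)" and i: "i \<in> {1..N}"
  shows "T j (lead v i u) = lead (v \<circ> adjswap j) (adjswap j i) (T j u)"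
proof -
  define v' where "v' = v \<circ> adjswap j"
  have v': "v' j = v (Suc j)" "v' (Suc j) = v j" "\<And>k. k \<noteq> j \<Longrightarrow> k \<noteq> Suc j \<Longrightarrow> v' k = v k"
    by (simp_all add: v'_def)
  have vi: "v' (adjswap j i) = v i" by (simp add: v'_def)
  consider "i = j" | "i = Suc j" | "i < j" | "Suc j < i" by linarith
  then have "T j (lead v i u) = lead v' (adjswap j i) (T j u)"
  proof cases
    \<comment> \<open>The letter \<open>j\<close> occurs as an inverse, last on the left and first
      on the right, and cancels against \<open>T j\<close> on both sides.\<close>
    case 1
    have A: "sgnprod (\<lambda>l. v' l < v j) (rev [1..<j]) w = sgnprod (\<lambda>l. v l < v j) (rev [1..<j]) w" for w
      by (intro sgnprod_cong) (simp add: v')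
    have B: "sgnprod (\<lambda>k. v' (Suc k) \<le> v j) (rev [Suc j..<N]) w
        = sgnprod (\<lambda>k. v (Suc k) \<le> v j) (rev [Suc j..<N]) w" for w
      by (intro sgnprod_cong) (simp add: v')
    have s: "[j..<N] = j # [Suc j..<N]" "[1..<Suc j] = [1..<j] @ [j]"
      using j by (auto simp: upt_conv_Cons)
    show ?thesis
      unfolding lead_def 1 vi s adjswap_simps using j lt
      by (simp add: v' A B sgnT_def del: upt_Suc One_nat_def)
  next
    \<comment> \<open>Here the letter \<open>j\<close> occurs with positive sign, and the outer
      \<open>T j\<close> of one side is the letter of the other.\<close>
    case 2
    have A: "sgnprod (\<lambda>l. v' l < v (Suc j)) (rev [1..<j]) w = sgnprod (\<lambda>l. v l < v (Suc j)) (rev [1..<j]) w" for w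
      by (intro sgnprod_cong) (simp add: v')
    have B: "sgnprod (\<lambda>k. v' (Suc k) \<le> v (Suc j)) (rev [Suc j..<N]) w
        = sgnprod (\<lambda>k. v (Suc k) \<le> v (Suc j)) (rev [Suc j..<N]) w" for w
      by (intro sgnprod_cong) (simp add: v')
    have s: "[j..<N] = j # [Suc j..<N]" "[1..<Suc j] = [1..<j] @ [j]"
      using j by (auto simp: upt_conv_Cons)
    show ?thesis
      unfolding lead_def 2 vi s adjswap_simps using j lt
      by (simp add: v' A B sgnT_def del: upt_Suc One_nat_def)
  next
    \<comment> \<open>The \<open>T j\<close> on the right passes the letters below \<open>i\<close>,
      is rotated to \<open>T h\<close>, and leaves the letters \<open>j\<close> and \<open>h\<close>
      as \<open>T j\<close> again by the braid relation.\<close>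
    case 3
    then obtain h where h: "j = Suc h" by (cases j) auto
    have hN: "1 \<le> h" "Suc h < N" "h \<in> {1..<N}" "i \<le> h" using 3 h j i by auto
    have ai: "adjswap j i = i" using 3 by simp
    have "[i..<N] = [i..<h] @ [h..<N]"
      using hN upt_add_eq_append[of i h "N - h"] by simp
    then have s: "rev [i..<N] = rev [Suc j..<N] @ [j, h] @ rev [i..<h]"
      using hN h by (simp add: upt_conv_Cons)
    have A: "sgnprod (\<lambda>l. v' l < v i) (rev [1..<i]) w = sgnprod (\<lambda>l. v l < v i) (rev [1..<i]) w" for w
      using 3 by (intro sgnprod_cong) (simp add: v')
    have B1: "sgnprod (\<lambda>k. v' (Suc k) \<le> v i) (rev [Suc j..<N]) w
        = sgnprod (\<lambda>k. v (Suc k) \<le> v i) (rev [Suc j..<N]) w" for w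
      by (intro sgnprod_cong) (simp add: v')
    have B2: "sgnprod (\<lambda>k. v' (Suc k) \<le> v i) (rev [i..<h]) w
        = sgnprod (\<lambda>k. v (Suc k) \<le> v i) (rev [i..<h]) w" for w
      using h by (intro sgnprod_cong) (simp add: v')
    have cA: "sgnprod f (rev [1..<i]) (T j w) = T j (sgnprod f (rev [1..<i]) w)" for f w
      using j 3 by (intro commute_sgnprod[symmetric]) auto
    have cW: "prodT [1..<N] (T j w) = T h (prodT [1..<N] w)" for w
      using prodT_rotate[OF hN(1,2)] h by simp
    have cB1: "sgnprod f (rev [Suc j..<N]) (T h w) = T h (sgnprod f (rev [Suc j..<N]) w)" for f w
      using hN h by (intro commute_sgnprod[symmetric]) auto
    have cB2: "T j (sgnprod f (rev [i..<h]) w) = sgnprod f (rev [i..<h]) (T j w)" for f w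
      using hN h j i by (intro commute_sgnprod) auto
    have br: "T j (sgnT (v j \<le> v i) h (sgnT (v (Suc j) \<le> v i) j w))
        = sgnT (v (Suc j) \<le> v i) h (sgnT (v j \<le> v i) j (T h w))" for w
      unfolding h using lt h by (intro braid_sgnT_up[OF hN(1,2), symmetric]) auto
    have "T j (lead v i u) = sgnprod (\<lambda>k. v (Suc k) \<le> v i) (rev [i..<h])
       (T j (sgnT (v j \<le> v i) h (sgnT (v (Suc j) \<le> v i) j (sgnprod (\<lambda>k. v (Suc k) \<le> v i) (rev [Suc j..<N])
         (prodT [1..<N] (sgnprod (\<lambda>l. v l < v i) (rev [1..<i]) u))))))"
      unfolding lead_def s by (simp add: cB2 h[symmetric] del: upt_Suc One_nat_def)
    also have "\<dots> = lead v' i (T j u)"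
      unfolding lead_def s br using 3 by (simp add: A B1 B2 cA cW cB1 v' h[symmetric] del: upt_Suc One_nat_def)
    finally show ?thesis by (simp add: ai)
  next
    \<comment> \<open>The \<open>T j\<close> braids through the letters \<open>Suc j\<close> and
      \<open>j\<close>, emerging as \<open>T (Suc j)\<close>, and the long product rotates it back
      to \<open>T j\<close>.\<close>
    case 4
    have jN: "1 \<le> j" "Suc j < N" "Suc j \<in> {1..<N}" using 4 j i by auto
    have ai: "adjswap j i = i" using 4 by simp
    have "[1..<i] = [1..<j] @ [j..<i]"
      using jN 4 upt_add_eq_append[of 1 j "i - j"] by simp
    then have s: "rev [1..<i] = rev [Suc (Suc j)..<i] @ [Suc j, j] @ rev [1..<j]"
      using 4 by (simp add: upt_conv_Cons)
    have A1: "sgnprod (\<lambda>l. v' l < v i) (rev [Suc (Suc j)..<i]) w = sgnprod (\<lambda>l. v l < v i) (rev [Suc (Suc j)..<i]) w" for w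
      by (intro sgnprod_cong) (simp add: v')
    have A2: "sgnprod (\<lambda>l. v' l < v i) (rev [1..<j]) w = sgnprod (\<lambda>l. v l < v i) (rev [1..<j]) w" for w
      by (intro sgnprod_cong) (simp add: v')
    have B: "sgnprod (\<lambda>k. v' (Suc k) \<le> v i) (rev [i..<N]) w
        = sgnprod (\<lambda>k. v (Suc k) \<le> v i) (rev [i..<N]) w" for w
      using 4 by (intro sgnprod_cong) (simp add: v')
    have cA1: "sgnprod f (rev [Suc (Suc j)..<i]) (T j w) = T j (sgnprod f (rev [Suc (Suc j)..<i]) w)" for f w
      using j i by (intro commute_sgnprod[symmetric]) auto
    have cA2: "sgnprod f (rev [1..<j]) (T (Suc j) w) = T (Suc j) (sgnprod f (rev [1..<j]) w)" for f w
      using jN by (intro commute_sgnprod[symmetric]) auto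
    have cB: "sgnprod f (rev [i..<N]) (T j w) = T j (sgnprod f (rev [i..<N]) w)" for f w
      using j i 4 by (intro commute_sgnprod[symmetric]) auto
    have br: "sgnT (v (Suc j) < v i) j (sgnT (v j < v i) (Suc j) (T j w))
        = T (Suc j) (sgnT (v j < v i) j (sgnT (v (Suc j) < v i) (Suc j) w))" for w
      using lt by (intro braid_sgnT_up[OF jN(1,2)]) auto
    have "lead v' i (T j u) = sgnprod (\<lambda>k. v (Suc k) \<le> v i) (rev [i..<N])
      (prodT [1..<N] (sgnprod (\<lambda>l. v l < v i) (rev [1..<j])
        (sgnT (v (Suc j) < v i) j (sgnT (v j < v i) (Suc j) (T j
          (sgnprod (\<lambda>l. v l < v i) (rev [Suc (Suc j)..<i]) u))))))"
      unfolding lead_def s using 4 by (simp add: A1 A2 B cA1 v' del: upt_Suc One_nat_def)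
    also have "\<dots> = T j (lead v i u)"
      unfolding br lead_def s by (simp add: cA2 cB prodT_rotate[OF jN(1,2)] del: upt_Suc One_nat_def)
    finally show ?thesis by (simp add: ai)
  qed
  then show ?thesis by (simp add: v'_def)
qed

text \<open>Minimal length forces every letter of the word to exchange an ascent of the current
  vector, so \<open>lead_adjswap\<close> applies at each letter until the vector is
  decreasing.\<close>

lemma lead_prodT:
  assumes "set ws \<subseteq> {1..<N}" "word_perm ws = rv N v" "length ws = card (inversions N (rv N v))"
    and "i \<in> {1..N}"
  shows "prodT ws (lead v i u) = jm (rv N v i) (prodT ws u)"
  using assms
proof (induction ws arbitrary: v i u)
  case Nil
  have "v (Suc j) \<le> v j" if "j \<in> {1..<N}" for j
    using Nil(2) rv_descent_iff[OF that, of v] by (metis id_apply not_less lessI less_asym' word_perm_Nil)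
  with Nil show ?case using lead_decreasing[of v i u] by (metis foldl_Nil id_apply word_perm_Nil)
next
  case (Cons j ws)
  have j: "j \<in> {1..<N}" and ws: "set ws \<subseteq> {1..<N}" using Cons.prems by auto
  have perm: "word_perm ws = rv N v \<circ> adjswap j"
    using Cons.prems(2) by (metis adjswap_comp_adjswap comp_assoc comp_id word_perm_Cons)
  have len: "Suc (length ws) = card (inversions N (rv N v))" using Cons.prems(3) by simp
  \<comment> \<open>Otherwise the remaining word would be shorter than the number of inversions of
    its permutation.\<close>
  have "\<not> rv N v j < rv N v (Suc j)"
    using card_inversions_adjswap(1)[OF j, of "rv N v"] card_inversions_word_perm[OF ws] len perm by auto
  moreover have "rv N v j \<noteq> rv N v (Suc j)"
    using rv_less[of j N "Suc j" v] rv_less[of "Suc j" N j v] j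
    by (cases "v j" "v (Suc j)" rule: linorder_cases) auto
  ultimately have desc: "rv N v (Suc j) < rv N v j" by simp
  then have lt: "v j < v (Suc j)" using rv_descent_iff[OF j] by simp
  have perm': "word_perm ws = rv N (v \<circ> adjswap j)"
    using perm rv_adjswap_comp[of j N v] j lt by simp
  have "length ws = card (inversions N (rv N (v \<circ> adjswap j)))"
    using card_inversions_adjswap(2)[OF j, of "rv N v"] desc len perm perm' by simp
  moreover have "adjswap j i \<in> {1..N}"
    using permutes_in_image[OF adjswap_permutes[OF j]] Cons.prems(4) by blast
  ultimately have "prodT ws (lead (v \<circ> adjswap j) (adjswap j i) (T j u))
      = jm (rv N (v \<circ> adjswap j) (adjswap j i)) (prodT ws (T j u))"
    using Cons.IH[OF ws perm'] by blast
  then show ?case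
    using lead_adjswap[where v = v, OF j lt Cons.prems(4)] by (simp add: rv_adjswap[OF j lt])
qed

end

section \<open>The order on exponents\<close>

lemma vplus_obtain_permutation:
  obtains p where "p permutes {1..N}" "\<And>i. i \<in> {1..N} \<Longrightarrow> vplus N v i = v (p i)"
proof -
  let ?xs = "map v [1..<Suc N]"
  let ?ys = "rev (sort ?xs)"
  have "mset ?ys = mset ?xs" by simp
  then obtain f where f: "f permutes {..<length ?xs}" "permute_list f ?xs = ?ys"
    by (rule mset_eq_permutation)
  have len: "length ?xs = N" by simp
  define p where "p i = (if i \<in> {1..N} then Suc (f (i - 1)) else i)" for i
  have fN: "f i < N \<longleftrightarrow> i < N" for i using permutes_in_image[OF f(1)] len by auto
  have "bij_betw p {1..N} {1..N}"
    unfolding bij_betw_def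
  proof
    show inj: "inj_on p {1..N}"
    proof
      fix a b assume ab: "a \<in> {1..N}" "b \<in> {1..N}" "p a = p b"
      then have "f (a - 1) = f (b - 1)" by (simp add: p_def)
      then have "a - 1 = b - 1" using permutes_inj[OF f(1)] by (simp add: inj_eq)
      then show "a = b" using ab by auto
    qed
    show "p ` {1..N} = {1..N}"
    proof (rule card_subset_eq)
      show "p ` {1..N} \<subseteq> {1..N}"
      proof
        fix y assume "y \<in> p ` {1..N}"
        then obtain a where a: "a \<in> {1..N}" "y = Suc (f (a - 1))" by (auto simp: p_def)
        then have "a - 1 < N" by auto
        then have "f (a - 1) < N" by (simp add: fN)
        then show "y \<in> {1..N}" using a by simp
      qed
      show "card (p ` {1..N}) = card {1..N}" using card_image[OF inj] .
    qed simp
  qed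
  then have "p permutes {1..N}" by (rule bij_imp_permutes) (simp add: p_def del: atLeastAtMost_iff)
  moreover have "vplus N v i = v (p i)" if i: "i \<in> {1..N}" for i
  proof -
    have "vplus N v i = permute_list f ?xs ! (i - 1)"
      using i f(2) by (simp add: vplus_def)
    also have "\<dots> = ?xs ! f (i - 1)"
      using i by (intro permute_list_nth[OF f(1)]) auto
    also have "\<dots> = v (p i)"
      using i fN[of "i - 1"] by (auto simp: p_def nth_upt simp del: upt_Suc)
    finally show ?thesis .
  qed
  ultimately show thesis using that by blast
qed

lemma vplus_antimono:
  assumes "1 \<le> i" "i \<le> j" "j \<le> N"
  shows "vplus N v j \<le> vplus N v i"
proof -
  let ?s = "sort (map v [1..<Suc N])"
  have "rev ?s ! (j - 1) \<le> rev ?s ! (i - 1)"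
    using assms by (intro sorted_rev_nth_mono) auto
  then show ?thesis using assms by (simp add: vplus_def)
qed

lemma vplus_comp_permutes:
  assumes "p permutes {1..N}"
  shows "vplus N (v \<circ> p) = vplus N v"
proof -
  have "mset (map (v \<circ> p) [1..<Suc N]) = image_mset v (image_mset p (mset_set {1..N}))"
    by (simp add: image_mset.compositionality atLeastLessThanSuc_atLeastAtMost del: upt_Suc)
  also have "image_mset p (mset_set {1..N}) = mset_set (p ` {1..N})"
    by (intro image_mset_mset_set permutes_inj_on[OF assms])
  also have "p ` {1..N} = {1..N}" using permutes_image[OF assms] .
  finally have "mset (map (v \<circ> p) [1..<Suc N]) = mset (map v [1..<Suc N])"
    by (simp add: comp_def atLeastLessThanSuc_atLeastAtMost del: upt_Suc)
  then have "sort (map (v \<circ> p) [1..<Suc N]) = sort (map v [1..<Suc N])"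
    by (metis sorted_list_of_multiset_mset)
  then show ?thesis unfolding vplus_def by (simp only:)
qed

text \<open>The indices of \<open>B\<close> beyond \<open>card B\<close> are as many as those
  missing from the initial segment, and \<open>w (card B)\<close> separates their values.\<close>

lemma sum_le_psum_antimono:
  fixes w :: "nat \<Rightarrow> nat"
  assumes anti: "\<And>i j. 1 \<le> i \<Longrightarrow> i \<le> j \<Longrightarrow> j \<le> N \<Longrightarrow> w j \<le> w i"
    and B: "B \<subseteq> {1..N}"
  shows "sum w B \<le> psum w (card B)"
proof -
  define k where "k = card B"
  have fin: "finite B" using B finite_subset by auto
  have kN: "k \<le> N" using card_mono[OF _ B] by (simp add: k_def)
  have card: "card (B - {1..k}) = card ({1..k} - B)"
    using card_Diff_subset_Int[of B "{1..k}"] card_Diff_subset_Int[of "{1..k}" B] fin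
    by (simp add: k_def Int_commute)
  have "sum w (B - {1..k}) \<le> sum w ({1..k} - B)"
  proof (cases "k = 0")
    case False
    have "sum w (B - {1..k}) \<le> card (B - {1..k}) * w k"
      using sum_bounded_above[of "B - {1..k}" w "w k"] B False anti[of k] by force
    also have "\<dots> \<le> sum w ({1..k} - B)"
      unfolding card using sum_bounded_below[of "{1..k} - B" "w k" w] kN anti[of _ k] by force
    finally show ?thesis .
  qed (use fin in \<open>simp add: k_def\<close>)
  moreover have "sum w B = sum w (B \<inter> {1..k}) + sum w (B - {1..k})"
    using fin by (subst sum.Int_Diff[of B w "{1..k}"]) auto
  moreover have "sum w {1..k} = sum w (B \<inter> {1..k}) + sum w ({1..k} - B)"
    by (subst sum.Int_Diff[of "{1..k}" w B]) (auto simp: Int_commute)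
  ultimately show ?thesis by (simp add: psum_def k_def)
qed

text \<open>Together with \<open>psum_vplus_obtain\<close> this makes a partial sum of
  \<open>vplus N v\<close> the maximum of \<open>sum v A\<close> over index sets of given size,
  which is how dominance is verified.\<close>

lemma sum_le_psum_vplus:
  assumes "A \<subseteq> {1..N}"
  shows "sum v A \<le> psum (vplus N v) (card A)"
proof -
  obtain p where p: "p permutes {1..N}" "\<And>i. i \<in> {1..N} \<Longrightarrow> vplus N v i = v (p i)"
    using vplus_obtain_permutation[of N v] by blast
  define B where "B = inv p ` A"
  have invp: "inv p permutes {1..N}" using permutes_inv[OF p(1)] .
  have B: "B \<subseteq> {1..N}" using assms permutes_image[OF invp] by (auto simp: B_def)
  have inj: "inj_on (inv p) A" using permutes_inj_on[OF invp] .
  have "sum (vplus N v) B = sum (\<lambda>a. vplus N v (inv p a)) A"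
    unfolding B_def by (simp add: sum.reindex[OF inj])
  also have "\<dots> = sum v A"
  proof (rule sum.cong)
    fix a assume "a \<in> A"
    then have "inv p a \<in> {1..N}" using B by (auto simp: B_def)
    then show "vplus N v (inv p a) = v a"
      using p permutes_inverses(1)[OF p(1)] by simp
  qed simp
  finally have "sum v A = sum (vplus N v) B" by simp
  also have "\<dots> \<le> psum (vplus N v) (card B)"
    using vplus_antimono B by (intro sum_le_psum_antimono) auto
  also have "card B = card A" unfolding B_def by (rule card_image[OF inj])
  finally show ?thesis .
qed

lemma psum_vplus_obtain:
  assumes "k \<le> N"
  obtains A where "A \<subseteq> {1..N}" "card A = k" "psum (vplus N v) k = sum v A"
proof -
  obtain p where p: "p permutes {1..N}" "\<And>i. i \<in> {1..N} \<Longrightarrow> vplus N v i = v (p i)"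
    using vplus_obtain_permutation[of N v] by blast
  have inj: "inj_on p {1..k}" using permutes_inj_on[OF p(1)] .
  have "p ` {1..k} \<subseteq> {1..N}"
    using permutes_image[OF p(1)] assms by (metis atLeastatMost_subset_iff image_mono order_refl)
  moreover have "card (p ` {1..k}) = k" using card_image[OF inj] by simp
  moreover have "psum (vplus N v) k = sum v (p ` {1..k})"
    unfolding psum_def using p(2) assms
    by (simp add: sum.reindex[OF inj] del: One_nat_def)
  ultimately show thesis using that by blast
qed

lemma sum_vplus: "(\<Sum>i\<in>{1..N}. f (vplus N v i)) = (\<Sum>i\<in>{1..N}. f (v i))"
proof -
  obtain p where p: "p permutes {1..N}" "\<And>i. i \<in> {1..N} \<Longrightarrow> vplus N v i = v (p i)"
    using vplus_obtain_permutation[of N v] by blast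
  have "(\<Sum>i\<in>{1..N}. f (vplus N v i)) = (\<Sum>i\<in>{1..N}. f (v (p i)))"
    using p(2) by simp
  also have "\<dots> = (\<Sum>i\<in>{1..N}. f (v i))"
    using sum.permute[OF p(1), of "\<lambda>i. f (v i)"] by (simp add: o_def)
  finally show ?thesis .
qed

text \<open>Widening a pair with fixed sum raises the rearrangement. For dominance, an index set
  meeting the pair in one point is moved to the position of \<open>max a b\<close>; for strictness,
  the sum of squares is an invariant of the rearrangement.\<close>

lemma vplus_spread:
  fixes a b :: nat
  assumes j: "j \<in> {1..<N}" and S: "v j + v (Suc j) = a + b"
    and spread: "v j < max a b" "v (Suc j) < max a b"
  defines "v' \<equiv> v(j := a, Suc j := b)"
  shows "vplus N v \<noteq> vplus N v'" and "dom_le N (vplus N v) (vplus N v')"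
proof -
  have jN: "j \<in> {1..N}" "Suc j \<in> {1..N}" using j by auto
  have v': "v' j = a" "v' (Suc j) = b" "\<And>k. k \<noteq> j \<Longrightarrow> k \<noteq> Suc j \<Longrightarrow> v' k = v k"
    by (simp_all add: v'_def)
  show "dom_le N (vplus N v) (vplus N v')"
    unfolding dom_le_def
  proof
    fix k assume "k \<in> {1..N}"
    then obtain A where A: "A \<subseteq> {1..N}" "card A = k" "psum (vplus N v) k = sum v A"
      using psum_vplus_obtain[of k N v] by auto
    have fin: "finite A" using A finite_subset by auto
    define C where "C = A - {j, Suc j}"
    have C: "finite C" "C \<subseteq> {1..N}" "j \<notin> C" "Suc j \<notin> C" using A fin by (auto simp: C_def)
    have same: "sum v' C = sum v C" using C v'(3) by (intro sum.cong) (auto, metis)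
    obtain l where l: "l = j \<or> l = Suc j" "v' l = max a b" using v' by (metis max_def)
    have "\<exists>A'. A' \<subseteq> {1..N} \<and> card A' = k \<and> sum v A \<le> sum v' A'"
    proof (cases "j \<in> A"; cases "Suc j \<in> A")
      assume "j \<in> A" "Suc j \<in> A"
      then have eq: "A = insert j (insert (Suc j) C)" by (auto simp: C_def)
      have "sum v A = sum v' A" unfolding eq using C S by (simp add: same v')
      then show ?thesis using A by auto
    next
      assume "j \<notin> A" "Suc j \<notin> A"
      then have "A = C" by (auto simp: C_def)
      then show ?thesis using A same by auto
    next
      assume "j \<in> A" "Suc j \<notin> A"
      then have eq: "A = insert j C" by (auto simp: C_def)
      have "card (insert l C) = k" "sum v A \<le> sum v' (insert l C)" "insert l C \<subseteq> {1..N}"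
        using C l A(2) jN spread same unfolding eq by auto
      then show ?thesis by blast
    next
      assume "j \<notin> A" "Suc j \<in> A"
      then have eq: "A = insert (Suc j) C" by (auto simp: C_def)
      have "card (insert l C) = k" "sum v A \<le> sum v' (insert l C)" "insert l C \<subseteq> {1..N}"
        using C l A(2) jN spread same unfolding eq by auto
      then show ?thesis by blast
    qed
    then show "psum (vplus N v) k \<le> psum (vplus N v') k"
      using A(3) sum_le_psum_vplus[of _ N v'] by (metis order_trans)
  qed
  show "vplus N v \<noteq> vplus N v'"
  proof
    assume eq: "vplus N v = vplus N v'"
    define C where "C = {1..N} - {j, Suc j}"
    have C: "{1..N} = insert j (insert (Suc j) C)" "finite C" "j \<notin> C" "Suc j \<notin> C"
      using jN by (auto simp: C_def)
    have same: "(\<Sum>i\<in>C. v' i * v' i) = (\<Sum>i\<in>C. v i * v i)" using C v'(3) by (intro sum.cong) (auto, metis)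
    have "(\<Sum>i\<in>{1..N}. v i * v i) = (\<Sum>i\<in>{1..N}. v' i * v' i)"
      using sum_vplus[of "\<lambda>x. x * x" N v] sum_vplus[of "\<lambda>x. x * x" N v'] eq by simp
    then have sq: "v j * v j + v (Suc j) * v (Suc j) = a * a + b * b"
      unfolding C(1) using C same by (simp add: v')
    have "(int (v j) + int (v (Suc j))) = int a + int b" using S by linarith
    moreover have "int (v j) * int (v j) + int (v (Suc j)) * int (v (Suc j)) = int a * int a + int b * int b"
      using arg_cong[OF sq, of int] by simp
    \<comment> \<open>Equal sums and equal sums of squares give equal products, so \<open>a\<close>
      is one of the two old entries.\<close>
    ultimately have "(int a - int (v j)) * (int a - int (v (Suc j))) = 0"
      by algebra
    then show False
      using spread S by (auto simp: max_def split: if_splits)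
  qed
qed

section \<open>The triangular order on exponent vectors\<close>

lemma expvecs_comp_permutes:
  assumes p: "p permutes {1..N}"
  shows "v \<circ> p \<in> expvecs N \<longleftrightarrow> v \<in> expvecs N"
proof -
  have "(v \<circ> p) i = v i" if "i \<notin> {1..N}" for i
    using permutes_not_in[OF p that] by simp
  then show ?thesis unfolding expvecs_def by force
qed

lemma vplus_in_expvecs [simp]: "vplus N v \<in> expvecs N"
  unfolding expvecs_def vplus_def by simp

lemma dom_le_antisym:
  assumes "dom_le N v w" "dom_le N w v" "v \<in> expvecs N" "w \<in> expvecs N"
  shows "v = w"
proof
  fix i
  have eq: "psum v i = psum w i" if "i \<in> {0..N}" for i
    using assms(1,2) that by (cases "i = 0") (auto simp: dom_le_def psum_def intro: antisym)
  show "v i = w i"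
  proof (cases "i \<in> {1..N}")
    case True
    then obtain k where k: "i = Suc k" "k < N" by (cases i) auto
    then show ?thesis using eq[of i] eq[of k] by (simp add: psum_def)
  next
    case False
    then show ?thesis using assms(3,4) unfolding expvecs_def by (simp del: atLeastAtMost_iff)
  qed
qed

lemma dom_le_trans: "dom_le N u v \<Longrightarrow> dom_le N v w \<Longrightarrow> dom_le N u w"
  unfolding dom_le_def using order_trans by blast

text \<open>The critical case is a chain that leaves a rearrangement and returns to it; antisymmetry
  of dominance on rearrangements excludes it.\<close>

lemma tri_le_trans:
  assumes "tri_le N u v" "tri_le N v w"
  shows "tri_le N u w"
  using assms dom_le_trans[of N] dom_le_antisym[of N "vplus N u" "vplus N v"]
  unfolding tri_le_def by (metis vplus_in_expvecs)

lemma tri_le_antisym: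
  assumes "tri_le N v w" "tri_le N w v" "v \<in> expvecs N" "w \<in> expvecs N"
  shows "v = w"
  using assms dom_le_antisym[of N "vplus N v" "vplus N w"] dom_le_antisym[of N v w]
  unfolding tri_le_def by (metis vplus_in_expvecs)

lemma tri_lt_trans:
  assumes "tri_lt N u v" "tri_lt N v w" "u \<in> expvecs N" "v \<in> expvecs N"
  shows "tri_lt N u w"
  using assms tri_le_trans[of N u v w] tri_le_antisym[of N u v] unfolding tri_lt_def by blast

text \<open>Moving the larger entry to the left raises the partial sums that end between the two
  positions and keeps the others.\<close>

lemma tri_lt_transpose:
  assumes a: "1 \<le> a" "a < b" "b \<le> N" and lt: "v a < v b"
  shows "tri_lt N v (v \<circ> transpose a b)"
proof -
  have p: "transpose a b permutes {1..N}" using a by (intro permutes_swap_id) auto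
  have "psum v k \<le> psum (v \<circ> transpose a b) k" if "k \<le> N" for k
  proof -
    consider "k < a" | "a \<le> k" "k < b" | "b \<le> k" by linarith
    then show ?thesis
    proof cases
      case 1
      then have "psum v k = psum (v \<circ> transpose a b) k"
        unfolding psum_def using a by (intro sum.cong) (auto simp: transpose_def)
      then show ?thesis by simp
    next
      case 2
      then show ?thesis
        unfolding psum_def using lt by (intro sum_mono) (auto simp: transpose_def)
    next
      case 3
      have "transpose a b permutes {1..k}" using a 3 by (intro permutes_swap_id) auto
      then have "psum v k = psum (v \<circ> transpose a b) k"
        unfolding psum_def by (metis sum.permute)
      then show ?thesis by simp
    qed
  qed
  then have "dom_le N v (v \<circ> transpose a b)" by (simp add: dom_le_def)
  moreover have "v \<noteq> v \<circ> transpose a b" using lt by (metis comp_apply less_irrefl transpose_apply_first)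
  ultimately show ?thesis
    by (simp add: tri_lt_def tri_le_def vplus_comp_permutes[OF p])
qed

lemma tri_lt_vplus:
  "vplus N v \<noteq> vplus N w \<Longrightarrow> dom_le N (vplus N v) (vplus N w) \<Longrightarrow> tri_lt N v w"
  by (auto simp: tri_lt_def tri_le_def)

lemma finite_has_tri_maximal:
  assumes "finite A" "A \<subseteq> expvecs N" "a \<in> A"
  obtains m where "m \<in> A" "m = a \<or> tri_lt N a m" "\<forall>x\<in>A. \<not> tri_lt N m x"
proof -
  let ?B = "{x\<in>A. x = a \<or> tri_lt N a x}"
  have tr: "transp_on ?B (tri_lt N)"
    using assms(2) tri_lt_trans by (intro transp_onI) blast
  have as: "asymp_on ?B (tri_lt N)"
    using assms(2) tri_lt_trans by (intro asymp_onI) (metis (no_types, lifting) mem_Collect_eq subsetD tri_lt_def)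
  obtain m where "m \<in> ?B" "\<forall>x\<in>?B. \<not> tri_lt N m x"
    using Finite_Set.bex_max_element[OF _ as tr] assms(1,3) by (auto simp: tri_lt_def)
  then show thesis
    using that[of m] tri_lt_trans assms(2,3) by blast
qed

section \<open>Triangularity\<close>

lemma prod_if_power:
  fixes c :: "'a::comm_monoid_mult"
  assumes "finite A"
  shows "(\<Prod>l\<in>A. if P l then c else 1) = c ^ card {l\<in>A. P l}"
  using assms by (simp add: prod.If_cases Int_def)

text \<open>The cycle accumulated once the inverse generators with indices \<open>i - 1\<close> down
  to \<open>l\<close> have acted.\<close>

definition shift_left :: "nat \<Rightarrow> nat \<Rightarrow> nat \<Rightarrow> nat" where
  "shift_left i l k = (if k = l then i else if l < k \<and> k \<le> i then k - 1 else k)"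

text \<open>The cycle that the generators with indices \<open>l - 1\<close> down to \<open>i\<close>
  still have to undo.\<close>

definition shift_right :: "nat \<Rightarrow> nat \<Rightarrow> nat \<Rightarrow> nat" where
  "shift_right i l k = (if k = l then i else if i \<le> k \<and> k < l then Suc k else k)"

lemma shift_left_step: "j < i \<Longrightarrow> shift_left i j = shift_left i (Suc j) \<circ> adjswap j"
  by (auto simp: fun_eq_iff shift_left_def adjswap_def)

lemma shift_right_step: "i \<le> k \<Longrightarrow> shift_right i k = shift_right i (Suc k) \<circ> adjswap k"
  by (auto simp: fun_eq_iff shift_right_def adjswap_def)

lemma shift_left_self [simp]: "shift_left i i = id"
  by (auto simp: fun_eq_iff shift_left_def)

lemma shift_right_self [simp]: "shift_right i i = id"
  by (auto simp: fun_eq_iff shift_right_def)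

lemma shift_left_permutes:
  assumes "j \<le> i" "1 \<le> j" "i \<le> N"
  shows "shift_left i j permutes {1..N}"
  using assms
proof (induction rule: inc_induct)
  case (step n)
  then show ?case
    unfolding shift_left_step[OF step(2)] by (intro permutes_compose adjswap_permutes) auto
qed (simp add: permutes_id)

lemma shift_right_permutes:
  assumes "i \<le> k" "1 \<le> i" "k \<le> N"
  shows "shift_right i k permutes {1..N}"
  using assms
proof (induction rule: dec_induct)
  case (step n)
  have "shift_right i (Suc n) = shift_right i n \<circ> adjswap n"
    using shift_right_step[OF step(1)] by (simp add: o_assoc [symmetric])
  then show ?case
    using step by (simp only:) (intro permutes_compose adjswap_permutes, auto)
qed (simp add: permutes_id)

section \<open>Leading coefficients under the generators\<close>

context shape
begin

sublocale H: hecke_action N hT hTinv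
  by unfold_locales (use hT_braid hT_commute in \<open>auto simp del: One_nat_def\<close>)

abbreviation zero_vec :: vec where "zero_vec \<equiv> (\<lambda>_. 0)"

lemma vTi_zero [simp]: "vTi N lam i zero_vec = zero_vec"
  by (simp add: vTi_def)

lemma vTs_zero: "vTs N lam ws zero_vec = zero_vec"
  unfolding vTs_def by (induction ws) simp_all

lemma tab_supported_scale: "tab_supported u \<Longrightarrow> tab_supported (\<lambda>T. c * u T)"
  by (simp add: tab_supported_def)

lemma sgnT_scale: "H.sgnT b j (\<lambda>T. c * u T) = (\<lambda>T. c * H.sgnT b j u T)"
  by (simp add: H.sgnT_def hT_scale hTinv_scale)

lemma sgnprod_scale: "H.sgnprod f ws (\<lambda>T. c * u T) = (\<lambda>T. c * H.sgnprod f ws u T)"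
  by (induction ws arbitrary: u) (simp_all add: sgnT_scale)

lemma tab_supported_sgnT: "tab_supported u \<Longrightarrow> tab_supported (H.sgnT b j u)"
  by (simp add: H.sgnT_def tab_supported_hT tab_supported_hTinv)

lemma tab_supported_sgnprod: "tab_supported u \<Longrightarrow> tab_supported (H.sgnprod f ws u)"
  by (induction ws arbitrary: u) (simp_all add: tab_supported_sgnT)

lemma vTs_eq_prodT:
  "set ws \<subseteq> {1..<N} \<Longrightarrow> tab_supported u \<Longrightarrow> vTs N lam ws u = H.prodT ws u"
  unfolding vTs_def
  by (induction ws arbitrary: u) (simp_all add: vTi_eq_hT tab_supported_hT del: One_nat_def)

lemma foldl_vTinv_eq:
  "set ws \<subseteq> {1..<N} \<Longrightarrow> tab_supported u \<Longrightarrow>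
    foldl (\<lambda>u j. vTinv N lam j u) u ws = H.sgnprod (\<lambda>_. False) ws u"
  by (induction ws arbitrary: u)
    (simp_all add: vTinv_eq_hTinv tab_supported_hTinv H.sgnT_def del: One_nat_def)

lemma prodT_inverse:
  "set ws \<subseteq> {1..<N} \<Longrightarrow> H.sgnprod (\<lambda>_. False) (rev ws) (H.prodT ws u) = u"
  by (induction ws arbitrary: u) (simp_all add: H.sgnT_def del: One_nat_def)

text \<open>The divided difference reaches \<open>x^\<beta>\<close> only from pairs of exponents at
  least as far apart as that of \<open>\<beta>\<close>. Strictly wider pairs are excluded by
  \<open>spread\<close>, leaving \<open>\<beta>\<close> and its swap; the half-open range in
  \<open>dcoef\<close> counts these only when \<open>\<beta> j < \<beta> (Suc j)\<close>.\<close>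

lemma mTi_eq:
  assumes spread: "\<And>a b. a + b = \<beta> j + \<beta> (Suc j) \<Longrightarrow> \<beta> j < max a b \<Longrightarrow> \<beta> (Suc j) < max a b \<Longrightarrow>
      F (\<beta>(j := a, Suc j := b)) = zero_vec"
  shows "mTi N lam j F \<beta> T' = (if \<beta> j < \<beta> (Suc j) then (1 - sK) * (F (\<beta> \<circ> adjswap j) T' - F \<beta> T') else 0)
    + vTi N lam j (F (\<beta> \<circ> adjswap j)) T'"
proof -
  define S where "S = \<beta> j + \<beta> (Suc j)"
  define L where "L \<longleftrightarrow> \<beta> j < \<beta> (Suc j)"
  have swap: "\<beta>(j := \<beta> (Suc j), Suc j := \<beta> j) = \<beta> \<circ> adjswap j"
    by (auto simp: fun_eq_iff adjswap_def)
  have summand: "dcoef m (S - m) (\<beta> j) * F (\<beta>(j := m, Suc j := S - m)) T'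
      = (if m = \<beta> (Suc j) then if L then F (\<beta> \<circ> adjswap j) T' else 0 else 0)
        - (if m = \<beta> j then if L then F \<beta> T' else 0 else 0)" if m: "m \<in> {0..S}" for m
  proof (cases "\<beta> j < max m (S - m) \<and> \<beta> (Suc j) < max m (S - m)")
    case True
    then have "F (\<beta>(j := m, Suc j := S - m)) = zero_vec"
      using spread[of m "S - m"] m by (simp add: S_def)
    moreover have "\<not> (L \<and> m = \<beta> (Suc j))" "\<not> (L \<and> m = \<beta> j)"
      using True by (auto simp: S_def L_def)
    ultimately show ?thesis by auto
  next
    case False
    consider "S - m \<le> \<beta> j" "\<beta> j < m" | "m \<le> \<beta> j" "\<beta> j < S - m"
      | "\<not> (S - m \<le> \<beta> j \<and> \<beta> j < m)" "\<not> (m \<le> \<beta> j \<and> \<beta> j < S - m)" by blast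
    then show ?thesis
    proof cases
      case 1
      then have "m = \<beta> (Suc j)" "S - m = \<beta> j" L "m \<noteq> \<beta> j"
        using False m by (auto simp: S_def L_def max_def split: if_splits)
      then show ?thesis using 1 by (simp add: dcoef_def swap)
    next
      case 2
      then have "m = \<beta> j" "S - m = \<beta> (Suc j)" L "m \<noteq> \<beta> (Suc j)"
        using False m by (auto simp: S_def L_def max_def split: if_splits)
      then show ?thesis using 2 by (simp add: dcoef_def)
    next
      case 3
      then have "dcoef m (S - m) (\<beta> j) = 0" by (auto simp: dcoef_def)
      moreover have "\<not> (L \<and> m = \<beta> (Suc j))" "\<not> (L \<and> m = \<beta> j)"
        using 3 by (auto simp: S_def L_def)
      ultimately show ?thesis by auto
    qed
  qed
  have "(\<Sum>m\<in>{0..S}. dcoef m (S - m) (\<beta> j) * F (\<beta>(j := m, Suc j := S - m)) T')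
      = (if L then F (\<beta> \<circ> adjswap j) T' else 0) - (if L then F \<beta> T' else 0)"
    by (subst sum.cong[OF refl summand]) (simp_all add: sum_subtractf S_def)
  then show ?thesis
    by (auto simp: mTi_def S_def L_def)
qed

text \<open>The factors of \<open>\<Xi>\<^sub>i\<close> are not triangular, but each of them becomes triangular once the
  exponents are relabelled by the shift that it performs; \<open>\<sigma>\<close> records the shift made so far.\<close>

definition lead_at :: "mon \<Rightarrow> (nat \<Rightarrow> nat) \<Rightarrow> melt \<Rightarrow> bool" where
  "lead_at v \<sigma> F \<longleftrightarrow> (\<forall>\<gamma>\<in>expvecs N. tri_lt N v \<gamma> \<longrightarrow> F (\<gamma> \<circ> \<sigma>) = zero_vec)"

lemma lead_at_above:
  assumes "lead_at v \<sigma> F" "v \<in> expvecs N" "\<gamma> = v \<or> tri_lt N v \<gamma>" "\<gamma> \<in> expvecs N" "tri_lt N \<gamma> \<gamma>'"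
    "\<gamma>' \<in> expvecs N"
  shows "F (\<gamma>' \<circ> \<sigma>) = zero_vec"
  using assms tri_lt_trans[of N v \<gamma> \<gamma>'] unfolding lead_at_def by blast

lemma comp_adjswap_eq:
  assumes "\<sigma> permutes {1..N}"
  shows "\<sigma> \<circ> adjswap j = transpose (\<sigma> j) (\<sigma> (Suc j)) \<circ> \<sigma>"
  using permutes_inj[OF assms]
  by (auto simp: fun_eq_iff adjswap_def transpose_def inj_eq)

section \<open>One generator acting at a relabelled leading exponent\<close>

context
  fixes v :: mon and \<sigma> :: "nat \<Rightarrow> nat" and F :: melt and j :: nat
  assumes v: "v \<in> expvecs N" and \<sigma>: "\<sigma> permutes {1..N}" and lead: "lead_at v \<sigma> F"
    and j: "j \<in> {1..<N}"
begin

text \<open>The order compares rearrangements first, and these do not see the relabelling, so a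
  wider pair lies above \<open>\<gamma>\<close> for every \<open>\<sigma>\<close>.\<close>

lemma spread_vanishes:
  fixes \<gamma>
  defines "\<beta> \<equiv> \<gamma> \<circ> (\<sigma> \<circ> adjswap j)"
  assumes \<gamma>: "\<gamma> \<in> expvecs N" "\<gamma> = v \<or> tri_lt N v \<gamma>"
    and ab: "a + b = \<beta> j + \<beta> (Suc j)" "\<beta> j < max a b" "\<beta> (Suc j) < max a b"
  shows "F (\<beta>(j := a, Suc j := b)) = zero_vec"
proof -
  define \<beta>' where "\<beta>' = \<beta>(j := a, Suc j := b)"
  have p: "\<sigma> \<circ> adjswap j permutes {1..N}"
    using \<sigma> adjswap_permutes[OF j] by (rule permutes_compose[rotated])
  have i: "inv \<sigma> permutes {1..N}" using permutes_inv[OF \<sigma>] .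
  have jN: "j \<in> {1..N}" "Suc j \<in> {1..N}" using j by auto
  have "\<beta> \<in> expvecs N" using \<gamma> expvecs_comp_permutes[OF p] by (simp add: \<beta>_def)
  then have "\<beta>' \<in> expvecs N" using jN unfolding expvecs_def \<beta>'_def by auto
  then have e: "\<beta>' \<circ> inv \<sigma> \<in> expvecs N" using expvecs_comp_permutes[OF i] by blast
  have "vplus N \<gamma> = vplus N \<beta>" unfolding \<beta>_def using vplus_comp_permutes[OF p] by simp
  moreover have "vplus N (\<beta>' \<circ> inv \<sigma>) = vplus N \<beta>'" using vplus_comp_permutes[OF i] .
  moreover have "vplus N \<beta> \<noteq> vplus N \<beta>'" "dom_le N (vplus N \<beta>) (vplus N \<beta>')"
    unfolding \<beta>'_def using vplus_spread[OF j, of \<beta> a b] ab by auto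
  ultimately have "tri_lt N \<gamma> (\<beta>' \<circ> inv \<sigma>)" by (intro tri_lt_vplus) auto
  then have "F (\<beta>' \<circ> inv \<sigma> \<circ> \<sigma>) = zero_vec" using lead_at_above[OF lead v \<gamma>(2,1) _ e] by blast
  then show ?thesis
    by (simp add: \<beta>'_def o_assoc [symmetric] permutes_inv_o(2)[OF \<sigma>])
qed

text \<open>In the original labels the swap at \<open>j\<close> is the transposition of
  \<open>\<sigma> j\<close> and \<open>\<sigma> (Suc j)\<close>, and the hypothesis says that it
  moves the larger entry to the left.\<close>

lemma swap_vanishes:
  assumes \<gamma>: "\<gamma> \<in> expvecs N" "\<gamma> = v \<or> tri_lt N v \<gamma>"
    and lt: "\<sigma> (Suc j) < \<sigma> j \<and> \<gamma> (\<sigma> (Suc j)) < \<gamma> (\<sigma> j) \<or> \<sigma> j < \<sigma> (Suc j) \<and> \<gamma> (\<sigma> j) < \<gamma> (\<sigma> (Suc j))"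
  shows "F (\<gamma> \<circ> (\<sigma> \<circ> adjswap j)) = zero_vec"
proof -
  have mem: "\<sigma> j \<in> {1..N}" "\<sigma> (Suc j) \<in> {1..N}"
    using permutes_in_image[OF \<sigma>] j by auto
  let ?t = "transpose (\<sigma> j) (\<sigma> (Suc j))"
  have "tri_lt N \<gamma> (\<gamma> \<circ> ?t)"
    using lt
  proof
    assume "\<sigma> (Suc j) < \<sigma> j \<and> \<gamma> (\<sigma> (Suc j)) < \<gamma> (\<sigma> j)"
    then have "tri_lt N \<gamma> (\<gamma> \<circ> transpose (\<sigma> (Suc j)) (\<sigma> j))"
      using mem by (intro tri_lt_transpose) auto
    then show ?thesis by (simp add: transpose_commute)
  next
    assume "\<sigma> j < \<sigma> (Suc j) \<and> \<gamma> (\<sigma> j) < \<gamma> (\<sigma> (Suc j))"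
    then show ?thesis using mem by (intro tri_lt_transpose) auto
  qed
  moreover have "\<gamma> \<circ> ?t \<in> expvecs N"
    using \<gamma>(1) expvecs_comp_permutes[OF permutes_swap_id[OF mem]] by blast
  ultimately have "F (\<gamma> \<circ> ?t \<circ> \<sigma>) = zero_vec"
    using lead_at_above[OF lead v \<gamma>(2,1)] by blast
  then show ?thesis by (simp add: comp_adjswap_eq[OF \<sigma>] o_assoc)
qed

lemma mTi_relabel:
  assumes \<gamma>: "\<gamma> \<in> expvecs N" "\<gamma> = v \<or> tri_lt N v \<gamma>"
  shows "mTi N lam j F (\<gamma> \<circ> (\<sigma> \<circ> adjswap j)) T'
    = (if \<gamma> (\<sigma> (Suc j)) < \<gamma> (\<sigma> j) then (1 - sK) * (F (\<gamma> \<circ> \<sigma>) T' - F (\<gamma> \<circ> (\<sigma> \<circ> adjswap j)) T') else 0)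
      + vTi N lam j (F (\<gamma> \<circ> \<sigma>)) T'"
proof -
  have "\<gamma> \<circ> (\<sigma> \<circ> adjswap j) \<circ> adjswap j = \<gamma> \<circ> \<sigma>"
    by (simp add: o_assoc [symmetric])
  then show ?thesis
    using mTi_eq[of "\<gamma> \<circ> (\<sigma> \<circ> adjswap j)" j F T'] spread_vanishes[OF \<gamma>] by simp
qed

text \<open>The swapped term vanishes, and what remains in the case of a strict inequality is the
  generator plus \<open>1 - sK\<close>, that is \<open>sK\<close> times its inverse. This is the
  source of the signs in \<open>lead\<close>.\<close>

lemma mTi_step:
  assumes lt: "\<sigma> (Suc j) < \<sigma> j" and supp: "tab_supported (F (v \<circ> \<sigma>))"
  shows "lead_at v (\<sigma> \<circ> adjswap j) (mTi N lam j F)"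
    and "mTi N lam j F (v \<circ> (\<sigma> \<circ> adjswap j)) = (if v (\<sigma> (Suc j)) < v (\<sigma> j)
      then (\<lambda>T'. sK * hTinv j (F (v \<circ> \<sigma>)) T') else hT j (F (v \<circ> \<sigma>)))"
proof -
  have *: "mTi N lam j F (\<gamma> \<circ> (\<sigma> \<circ> adjswap j)) T'
    = (if \<gamma> (\<sigma> (Suc j)) < \<gamma> (\<sigma> j) then (1 - sK) * F (\<gamma> \<circ> \<sigma>) T' else 0) + vTi N lam j (F (\<gamma> \<circ> \<sigma>)) T'"
    if "\<gamma> \<in> expvecs N" "\<gamma> = v \<or> tri_lt N v \<gamma>" for \<gamma> T'
    using mTi_relabel[OF that] swap_vanishes[OF that] lt by simp
  show "lead_at v (\<sigma> \<circ> adjswap j) (mTi N lam j F)"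
    unfolding lead_at_def
  proof (intro ballI impI ext)
    fix \<gamma> T' assume \<gamma>: "\<gamma> \<in> expvecs N" "tri_lt N v \<gamma>"
    then have "F (\<gamma> \<circ> \<sigma>) = zero_vec" using lead by (simp add: lead_at_def)
    then show "mTi N lam j F (\<gamma> \<circ> (\<sigma> \<circ> adjswap j)) T' = 0" using * \<gamma> by simp
  qed
  show "mTi N lam j F (v \<circ> (\<sigma> \<circ> adjswap j)) = (if v (\<sigma> (Suc j)) < v (\<sigma> j)
      then (\<lambda>T'. sK * hTinv j (F (v \<circ> \<sigma>)) T') else hT j (F (v \<circ> \<sigma>)))"
    using *[OF v] vTi_eq_hT[OF j supp]
    by (simp add: fun_eq_iff hTinv_def mult.assoc[symmetric] add.commute)
qed

text \<open>The summand \<open>1 - sK\<close> of the inverse multiplies a swapped coefficient. It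
  vanishes for \<open>\<gamma> (\<sigma> j) < \<gamma> (\<sigma> (Suc j))\<close>, which leaves the
  plain generator; for the opposite strict inequality it cancels against the divided difference, and
  for equality the swap is trivial, so the inverse survives in both.\<close>

lemma mTinv_step:
  assumes lt: "\<sigma> j < \<sigma> (Suc j)" and supp: "tab_supported (F (v \<circ> \<sigma>))"
  shows "lead_at v (\<sigma> \<circ> adjswap j) (mTinv N lam j F)"
    and "mTinv N lam j F (v \<circ> (\<sigma> \<circ> adjswap j)) = (if v (\<sigma> j) < v (\<sigma> (Suc j))
      then (\<lambda>T'. inverse sK * hT j (F (v \<circ> \<sigma>)) T') else hTinv j (F (v \<circ> \<sigma>)))"
proof -
  have *: "mTinv N lam j F (\<gamma> \<circ> (\<sigma> \<circ> adjswap j)) T'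
    = inverse sK * ((if \<gamma> (\<sigma> j) < \<gamma> (\<sigma> (Suc j)) then 0 else (1 - sK) * F (\<gamma> \<circ> \<sigma>) T') + vTi N lam j (F (\<gamma> \<circ> \<sigma>)) T')"
    if \<gamma>: "\<gamma> \<in> expvecs N" "\<gamma> = v \<or> tri_lt N v \<gamma>" for \<gamma> T'
  proof (cases "\<gamma> (\<sigma> j)" "\<gamma> (\<sigma> (Suc j))" rule: linorder_cases)
    case less
    then have "F (\<gamma> \<circ> (\<sigma> \<circ> adjswap j)) = zero_vec" using swap_vanishes[OF \<gamma>] lt by simp
    then show ?thesis using less mTi_relabel[OF \<gamma>] by (simp add: mTinv_def)
  next
    case equal
    then have "\<gamma> \<circ> (\<sigma> \<circ> adjswap j) = \<gamma> \<circ> \<sigma>" by (auto simp: fun_eq_iff adjswap_def)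
    then show ?thesis
      using equal mTi_relabel[OF \<gamma>, of T'] by (simp add: mTinv_def add.commute)
  next
    case greater
    then show ?thesis
      unfolding mTinv_def mTi_relabel[OF \<gamma>] by (simp add: right_diff_distrib)
  qed
  show "lead_at v (\<sigma> \<circ> adjswap j) (mTinv N lam j F)"
    unfolding lead_at_def
  proof (intro ballI impI ext)
    fix \<gamma> T' assume \<gamma>: "\<gamma> \<in> expvecs N" "tri_lt N v \<gamma>"
    then have "F (\<gamma> \<circ> \<sigma>) = zero_vec" using lead by (simp add: lead_at_def)
    then show "mTinv N lam j F (\<gamma> \<circ> (\<sigma> \<circ> adjswap j)) T' = 0" using * \<gamma> by simp
  qed
  show "mTinv N lam j F (v \<circ> (\<sigma> \<circ> adjswap j)) = (if v (\<sigma> j) < v (\<sigma> (Suc j))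
      then (\<lambda>T'. inverse sK * hT j (F (v \<circ> \<sigma>)) T') else hTinv j (F (v \<circ> \<sigma>)))"
    using *[OF v] vTi_eq_hT[OF j supp]
    by (simp add: fun_eq_iff hTinv_def add.commute)
qed

end

text \<open>A letter that turns from an inverse into a generator leaves a factor
  \<open>inverse sK\<close> behind, which the product collects.\<close>

lemma left_phase:
  assumes v: "v \<in> expvecs N" and lead: "lead_at v id F" and supp: "tab_supported (F v)"
    and i: "i \<le> N" and "j \<le> i" "1 \<le> j"
  shows "lead_at v (shift_left i j) (foldl (\<lambda>G j. mTinv N lam j G) F (rev [j..<i])) \<and>
    foldl (\<lambda>G j. mTinv N lam j G) F (rev [j..<i]) (v \<circ> shift_left i j)
      = (\<lambda>T. (\<Prod>l\<in>{j..<i}. if v l < v i then inverse sK else 1)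
          * H.sgnprod (\<lambda>l. v l < v i) (rev [j..<i]) (F v) T)"
  using \<open>j \<le> i\<close> \<open>1 \<le> j\<close>
proof (induction rule: inc_induct)
  case base
  show ?case using lead by (simp add: id_def)
next
  case (step j)
  define G where "G = foldl (\<lambda>G j. mTinv N lam j G) F (rev [Suc j..<i])"
  define c where "c = (\<Prod>l\<in>{Suc j..<i}. if v l < v i then inverse sK else 1)"
  define X where "X = H.sgnprod (\<lambda>l. v l < v i) (rev [Suc j..<i]) (F v)"
  define \<sigma> where "\<sigma> = shift_left i (Suc j)"
  have G: "lead_at v \<sigma> G" "G (v \<circ> \<sigma>) = (\<lambda>T. c * X T)"
    using step by (auto simp: G_def c_def X_def \<sigma>_def o_def)
  have X: "tab_supported X" unfolding X_def by (rule tab_supported_sgnprod[OF supp])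
  have jN: "j \<in> {1..<N}" using step i by auto
  have p: "\<sigma> permutes {1..N}" unfolding \<sigma>_def using step i by (intro shift_left_permutes) auto
  \<comment> \<open>Position \<open>j\<close> still has its own label and the next one carries
    \<open>i\<close>, so this step compares \<open>v j\<close> with \<open>v i\<close>.\<close>
  have \<sigma>j: "\<sigma> j = j" "\<sigma> (Suc j) = i" using step by (auto simp: \<sigma>_def shift_left_def)
  have s: "shift_left i j = \<sigma> \<circ> adjswap j" unfolding \<sigma>_def using step by (intro shift_left_step) auto
  have w: "[j..<i] = j # [Suc j..<i]" using step by (simp add: upt_conv_Cons)
  have "\<sigma> j < \<sigma> (Suc j)" using \<sigma>j step by simp
  note st = mTinv_step[OF v p G(1) jN this]
  have "tab_supported (G (v \<circ> \<sigma>))" using G(2) tab_supported_scale[OF X] by simp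
  note st = st[OF this]
  have "{j..<i} = insert j {Suc j..<i}" using step by auto
  then have pr: "(\<Prod>l\<in>{j..<i}. if v l < v i then inverse sK else 1)
      = (if v j < v i then inverse sK else 1) * c"
    by (simp add: c_def)
  have "mTinv N lam j G (v \<circ> shift_left i j)
      = (\<lambda>T. (if v j < v i then inverse sK else 1) * c * H.sgnT (v j < v i) j X T)"
    unfolding s st(2) unfolding G(2) \<sigma>j by (auto simp: H.sgnT_def hT_scale hTinv_scale)
  then show ?case
    using st(1) by (simp add: w pr s o_def flip: G_def X_def)
qed

lemma right_phase:
  assumes v: "v \<in> expvecs N" and lead: "lead_at v (shift_right i N) F"
    and val: "F (v \<circ> shift_right i N) = u" and supp: "tab_supported u"
    and i: "1 \<le> i" and "k \<le> N" "i \<le> k"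
  shows "lead_at v (shift_right i k) (foldl (\<lambda>G j. mTi N lam j G) F (rev [k..<N])) \<and>
    foldl (\<lambda>G j. mTi N lam j G) F (rev [k..<N]) (v \<circ> shift_right i k)
      = (\<lambda>T. (\<Prod>l\<in>{k..<N}. if v i < v (Suc l) then sK else 1)
          * H.sgnprod (\<lambda>l. v (Suc l) \<le> v i) (rev [k..<N]) u T)"
  using \<open>k \<le> N\<close> \<open>i \<le> k\<close>
proof (induction rule: inc_induct)
  case base
  show ?case using lead val by (simp add: o_def)
next
  case (step k)
  define G where "G = foldl (\<lambda>G j. mTi N lam j G) F (rev [Suc k..<N])"
  define c where "c = (\<Prod>l\<in>{Suc k..<N}. if v i < v (Suc l) then sK else 1)"
  define X where "X = H.sgnprod (\<lambda>l. v (Suc l) \<le> v i) (rev [Suc k..<N]) u"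
  define \<sigma> where "\<sigma> = shift_right i (Suc k)"
  have G: "lead_at v \<sigma> G" "G (v \<circ> \<sigma>) = (\<lambda>T. c * X T)"
    using step by (auto simp: G_def c_def X_def \<sigma>_def o_def)
  have X: "tab_supported X" unfolding X_def by (rule tab_supported_sgnprod[OF supp])
  have kN: "k \<in> {1..<N}" using step i by auto
  have p: "\<sigma> permutes {1..N}" unfolding \<sigma>_def using step i by (intro shift_right_permutes) auto
  \<comment> \<open>After the rotation the label at position \<open>k\<close> is
    \<open>Suc k\<close>; hence the offset in the comparison of \<open>v (Suc k)\<close> with
    \<open>v i\<close>.\<close>
  have \<sigma>k: "\<sigma> k = Suc k" "\<sigma> (Suc k) = i" using step by (auto simp: \<sigma>_def shift_right_def)
  have s: "shift_right i k = \<sigma> \<circ> adjswap k" unfolding \<sigma>_def using step by (intro shift_right_step) auto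
  have w: "[k..<N] = k # [Suc k..<N]" using step by (simp add: upt_conv_Cons)
  have "\<sigma> (Suc k) < \<sigma> k" using \<sigma>k step by simp
  note st = mTi_step[OF v p G(1) kN this]
  have "tab_supported (G (v \<circ> \<sigma>))" using G(2) tab_supported_scale[OF X] by simp
  note st = st[OF this]
  have "{k..<N} = insert k {Suc k..<N}" using step by auto
  then have pr: "(\<Prod>l\<in>{k..<N}. if v i < v (Suc l) then sK else 1)
      = (if v i < v (Suc k) then sK else 1) * c"
    by (simp add: c_def)
  have "mTi N lam k G (v \<circ> shift_right i k)
      = (\<lambda>T. (if v i < v (Suc k) then sK else 1) * c * H.sgnT (v (Suc k) \<le> v i) k X T)"
    unfolding s st(2) unfolding G(2) \<sigma>k by (auto simp: H.sgnT_def hT_scale hTinv_scale not_le)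
  then show ?case
    using st(1) by (simp add: w pr s o_def flip: G_def X_def)
qed

text \<open>The rotation of variables turns one cycle into the other. The exponent that it moves to
  the end is the one labelled \<open>i\<close>, which accounts for the power of
  \<open>qK\<close>.\<close>

lemma mw_shift:
  assumes i: "i \<in> {1..N}" and \<gamma>: "\<gamma> \<in> expvecs N"
  shows "mw N lam F (\<gamma> \<circ> shift_right i N)
    = (\<lambda>T'. qK ^ \<gamma> i * vTs N lam [1..<N] (F (\<gamma> \<circ> shift_left i 1)) T')"
proof -
  have p: "shift_right i N permutes {1..N}" using i by (intro shift_right_permutes) auto
  have "\<gamma> \<circ> shift_right i N \<in> expvecs N" using expvecs_comp_permutes[OF p] \<gamma> by blast
  moreover have "(\<lambda>k. if k = 1 then (\<gamma> \<circ> shift_right i N) N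
      else if 2 \<le> k \<and> k \<le> N then (\<gamma> \<circ> shift_right i N) (k - 1) else 0) = \<gamma> \<circ> shift_left i 1"
  proof
    fix k
    have "\<gamma> k = 0" if "k = 0 \<or> k > N" using \<gamma> that by (auto simp: expvecs_def)
    then show "(if k = 1 then (\<gamma> \<circ> shift_right i N) N
      else if 2 \<le> k \<and> k \<le> N then (\<gamma> \<circ> shift_right i N) (k - 1) else 0) = (\<gamma> \<circ> shift_left i 1) k"
      using i by (auto simp: shift_left_def shift_right_def)
  qed
  moreover have "shift_right i N N = i" by (simp add: shift_right_def)
  ultimately show ?thesis by (simp add: mw_def Let_def)
qed

text \<open>The rank of \<open>i\<close> is \<open>i\<close> minus the number of smaller entries to
  its left plus the number of larger entries to its right; the two products count these.\<close>

lemma rv_scalar: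
  assumes i: "i \<in> {1..N}"
  shows "sK powi (int i - int N) * (\<Prod>l\<in>{i..<N}. if v i < v (Suc l) then sK else 1)
    * (\<Prod>l\<in>{1..<i}. if v l < v i then inverse sK else 1) = sK powi (int (rv N v i) - int N)"
proof -
  define A where "A = card {l\<in>{1..<i}. v l < v i}"
  define B where "B = card {l\<in>{Suc i..N}. v i < v l}"
  have "{l\<in>{Suc i..N}. v i < v l} = Suc ` {l\<in>{i..<N}. v i < v (Suc l)}"
    by (auto simp: image_iff) (metis Suc_le_D Suc_le_mono Suc_le_lessD)
  then have B: "card {l\<in>{i..<N}. v i < v (Suc l)} = B"
    unfolding B_def by (simp add: card_image)
  have "{1..i} = {j\<in>{1..i}. v i \<le> v j} \<union> {l\<in>{1..<i}. v l < v i}"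
    using i by (auto simp: not_less le_less)
  moreover have "{j\<in>{1..i}. v i \<le> v j} \<inter> {l\<in>{1..<i}. v l < v i} = {}" by auto
  ultimately have "card {1..i} = card {j\<in>{1..i}. v i \<le> v j} + A"
    unfolding A_def by (metis (no_types, lifting) card_Un_disjoint finite_Un finite_atLeastAtMost)
  then have "rv N v i + A = i + B" using i by (simp add: rv_def B_def)
  then have e: "int (rv N v i) - int N = (int i - int N) + (int B - int A)" by simp
  show ?thesis
    unfolding e prod_if_power[OF finite_atLeastLessThan] B A_def[symmetric]
    by (simp add: power_int_add power_int_diff power_inverse divide_inverse)
qed

text \<open>The relabelling runs from the identity to \<open>shift_left i 1\<close>, is turned by
  \<open>mw\<close> into \<open>shift_right i N\<close>, and ends at the identity, so the whole
  operator is evaluated at \<open>v\<close> itself.\<close>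

lemma mXi_lead:
  assumes v: "v \<in> expvecs N" and lead: "lead_at v id F" and supp: "tab_supported (F v)"
    and i: "i \<in> {1..N}"
  shows "mXi N lam i F v = (\<lambda>T. qK ^ v i * sK powi (int (rv N v i) - int N) * H.lead v i (F v) T)"
proof -
  define c where "c = (\<Prod>l\<in>{1..<i}. if v l < v i then inverse sK else 1)"
  define d where "d = (\<Prod>l\<in>{i..<N}. if v i < v (Suc l) then sK else 1)"
  define X where "X = H.sgnprod (\<lambda>l. v l < v i) (rev [1..<i]) (F v)"
  define Y where "Y = H.prodT [1..<N] X"
  define G where "G = foldl (\<lambda>G j. mTinv N lam j G) F (rev [1..<i])"
  define W where "W = mw N lam G"
  have G: "lead_at v (shift_left i 1) G" "G (v \<circ> shift_left i 1) = (\<lambda>T. c * X T)"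
    using left_phase[OF v lead supp, of i 1] i by (auto simp: G_def c_def X_def)
  have X: "tab_supported X" unfolding X_def by (rule tab_supported_sgnprod[OF supp])
  have Y: "tab_supported Y" unfolding Y_def H.prodT_eq_sgnprod by (rule tab_supported_sgnprod[OF X])
  have Wlead: "lead_at v (shift_right i N) W"
    using G(1) by (auto simp: lead_at_def W_def mw_shift[OF i] vTs_zero)
  have "vTs N lam [1..<N] (\<lambda>T. c * X T) = H.prodT [1..<N] (\<lambda>T. c * X T)"
    by (intro vTs_eq_prodT tab_supported_scale[OF X]) auto
  then have Wval: "W (v \<circ> shift_right i N) = (\<lambda>T. qK ^ v i * c * Y T)"
    unfolding W_def mw_shift[OF i v] G(2) Y_def H.prodT_eq_sgnprod sgnprod_scale
    by (simp add: mult.assoc)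
  have "foldl (\<lambda>G j. mTi N lam j G) W (rev [i..<N]) v
      = (\<lambda>T. d * (qK ^ v i * c * H.sgnprod (\<lambda>l. v (Suc l) \<le> v i) (rev [i..<N]) Y T))"
    using right_phase[OF v Wlead Wval tab_supported_scale[OF Y], of i] i
    by (simp add: d_def sgnprod_scale)
  then have "mXi N lam i F v = (\<lambda>T. qK ^ v i * (sK powi (int i - int N) * d * c) *
      H.sgnprod (\<lambda>l. v (Suc l) \<le> v i) (rev [i..<N]) Y T)"
    unfolding mXi_def G_def[symmetric] W_def[symmetric] by (simp add: mult_ac)
  then show ?thesis
    unfolding H.lead_def using rv_scalar[OF i, of v] by (simp add: c_def d_def Y_def X_def)
qed

end

section \<open>The leading term of a joint eigenfunction\<close>

theorem theorem4p2:
  fixes N :: nat and lam :: "nat list" and T :: tab and v :: mon and F :: melt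
  assumes "2 \<le> N"
    and "is_partition N lam"
    and "T \<in> Tab N lam"
    and "v \<in> expvecs N"
    and "melt_valid N lam F"
    and "F \<noteq> (\<lambda>_ _. 0)"
    and "\<forall>i\<in>{1..N}. mXi N lam i F = (\<lambda>\<beta> T'. qK ^ v i * sK powi CT T (rv N v i) * F \<beta> T')"
  shows "\<exists>(c::K) (u::mon \<Rightarrow> vec). c \<noteq> 0 \<and>
           (\<forall>\<beta>\<in>expvecs N. \<forall>T'.
              F \<beta> T' = (if \<beta> = v then c * vRv N lam v (basis T) T' else 0)
                       + (if tri_lt N \<beta> v then u \<beta> T' else 0))"
proof -
  interpret shape N lam by unfold_locales fact
  define A where "A = {\<beta>. F \<beta> \<noteq> zero_vec}"
  have A: "finite A" "A \<subseteq> expvecs N" and supp: "\<And>\<beta>. tab_supported (F \<beta>)"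
    using assms(5) by (auto simp: melt_valid_def A_def tab_supported_def)
  \<comment> \<open>Since every maximal exponent turns out to be \<open>v\<close>, all exponents of
    \<open>F\<close> lie weakly below \<open>v\<close>.\<close>
  have max: "m = v \<and> H.prodT ws (F m) = (\<lambda>T'. H.prodT ws (F m) T * basis T T') \<and> H.prodT ws (F m) T \<noteq> 0"
    if m: "m \<in> A" "\<forall>x\<in>A. \<not> tri_lt N m x" and ws: "reduced_word N (rv N m) ws" for m ws
  proof -
    define u where "u = H.prodT ws (F m)"
    have set: "set ws \<subseteq> {1..<N}" and perm: "word_perm ws = rv N m" using ws by (auto simp: reduced_word_def)
    have mN: "m \<in> expvecs N" using m A by blast
    have lead: "lead_at m id F" using m(2) by (auto simp: lead_at_def A_def)
    have scale: "H.prodT ws (\<lambda>S. c * w S) = (\<lambda>S. c * H.prodT ws w S)" for c w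
      unfolding H.prodT_eq_sgnprod by (rule sgnprod_scale)
    have usupp: "tab_supported u" unfolding u_def H.prodT_eq_sgnprod by (rule tab_supported_sgnprod[OF supp])
    have rvN: "rv N m i \<in> {1..N}" if "i \<in> {1..N}" for i
      using that permutes_in_image[OF word_perm_permutes[OF set]] perm by metis
    have eig: "qK ^ m i * sK powi CT S (rv N m i) * u S = qK ^ v i * sK powi CT T (rv N v i) * u S"
      if i: "i \<in> {1..N}" and S: "S \<in> Tabs" for i S
    proof -
      let ?k = "rv N m i"
      have "(\<lambda>S. qK ^ m i * sK powi (int ?k - int N) * H.lead m i (F m) S)
          = (\<lambda>S. qK ^ v i * sK powi CT T (rv N v i) * F m S)"
        using mXi_lead[OF mN lead supp i] assms(7) i by (metis (no_types, lifting))
      from arg_cong[OF this, of "H.prodT ws"]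
      have e1: "qK ^ m i * sK powi (int ?k - int N) * H.jm ?k u S = qK ^ v i * sK powi CT T (rv N v i) * u S"
        unfolding scale u_def H.lead_prodT[OF set perm reduced_word_rv_length[OF ws] i]
        by (rule fun_cong)
      have e2: "H.jm ?k u S = sK ^ (N - ?k) * sK powi CT S ?k * u S"
        unfolding H.jm_def using rvN[OF i] S by (intro jucys_murphy) auto
      \<comment> \<open>The scalar produced by the leading part exactly normalises
        \<open>jm\<close>.\<close>
      have e3: "sK powi (int ?k - int N) * sK ^ (N - ?k) = 1"
        using rvN[OF i] by (simp add: of_nat_diff flip: power_int_of_nat power_int_add)
      have "qK ^ m i * sK powi CT S ?k * u S
          = qK ^ m i * (sK powi (int ?k - int N) * sK ^ (N - ?k)) * sK powi CT S ?k * u S"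
        unfolding e3 by simp
      also have "\<dots> = qK ^ m i * sK powi (int ?k - int N) * H.jm ?k u S"
        unfolding e2 by (simp only: mult.assoc)
      also note e1
      finally show ?thesis .
    qed
    have uniq: "m = v \<and> S = T" if "u S \<noteq> 0" for S
    proof -
      have S: "S \<in> Tabs" using usupp that by (auto simp: tab_supported_def)
      have e: "qK ^ m i * sK powi CT S (rv N m i) = qK ^ v i * sK powi CT T (rv N v i)" if "i \<in> {1..N}" for i
        using eig[OF that S] \<open>u S \<noteq> 0\<close> by simp
      have "m i = v i" for i
      proof (cases "i \<in> {1..N}")
        case True
        then show ?thesis using qK_sK_independent(1)[OF e] by blast
      qed (use mN assms(4) in \<open>simp add: expvecs_def\<close>)
      then have mv: "m = v" by blast
      \<comment> \<open>The eigenvalues give contents only at ranks, but \<open>rv N m\<close> is a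
        permutation, so every entry \<open>k\<close> is a rank.\<close>
      have "CT S k = CT T k" if "k \<in> {1..N}" for k
      proof -
        have "k \<in> rv N m ` {1..N}"
          using permutes_image[OF word_perm_permutes[OF set]] that unfolding perm by (simp only:)
        then obtain i where "i \<in> {1..N}" "k = rv N m i" by (rule imageE)
        then show ?thesis using qK_sK_independent(2)[OF e] mv by blast
      qed
      then have "S = T" using Tab_eqI[OF S assms(3)] by blast
      with mv show ?thesis by blast
    qed
    have "u \<noteq> zero_vec"
    proof
      assume "u = zero_vec"
      then have "F m = (\<lambda>S. 0 * F m S)"
        using prodT_inverse[OF set, of "F m"] sgnprod_scale[of "\<lambda>_. False" "rev ws" 0 "F m"]
        by (simp add: u_def)
      then show False using m by (simp add: A_def)
    qed
    then obtain S where "u S \<noteq> 0" by blast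
    then have "m = v" "u T \<noteq> 0" using uniq by blast+
    moreover have "u = (\<lambda>S. u T * basis T S)"
    proof
      fix S show "u S = u T * basis T S" using uniq[of S] by (cases "S = T") (auto simp: basis_def)
    qed
    ultimately show ?thesis unfolding u_def[symmetric] by blast
  qed
  have below: "a = v \<or> tri_lt N a v" if "a \<in> A" for a
  proof -
    obtain m where m: "m \<in> A" "m = a \<or> tri_lt N a m" "\<forall>x\<in>A. \<not> tri_lt N m x"
      using finite_has_tri_maximal[OF A \<open>a \<in> A\<close>] by blast
    obtain ws where "reduced_word N (rv N m) ws" using ex_reduced_word_rv by blast
    then show ?thesis using max[OF m(1,3)] m(2) by blast
  qed
  define ws where "ws = (SOME ws. reduced_word N (rv N v) ws)"
  have ws: "reduced_word N (rv N v) ws"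
    unfolding ws_def by (rule someI_ex[OF ex_reduced_word_rv])
  have set: "set ws \<subseteq> {1..<N}" using ws by (simp add: reduced_word_def)
  obtain a where "a \<in> A" using assms(6) unfolding A_def by fast
  then obtain m where m: "m \<in> A" "\<forall>x\<in>A. \<not> tri_lt N m x"
    using finite_has_tri_maximal[OF A] by blast
  obtain ws' where "reduced_word N (rv N m) ws'" using ex_reduced_word_rv by blast
  then have "m = v" using max[OF m] by blast
  \<comment> \<open>The leading coefficient transported by \<open>ws\<close> is supported at
    \<open>T\<close> alone; \<open>c\<close> is its coordinate there, and transporting back yields
    \<open>vRv\<close>.\<close>
  define c where "c = H.prodT ws (F v) T"
  have c: "c \<noteq> 0" "H.prodT ws (F v) = (\<lambda>T'. c * basis T T')"
    using max[OF m, unfolded \<open>m = v\<close>, OF ws] by (simp_all add: c_def)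
  have "tab_supported (basis T)" using assms(3) by (auto simp: tab_supported_def basis_def)
  then have R: "vRv N lam v (basis T) = H.sgnprod (\<lambda>_. False) (rev ws) (basis T)"
    using set by (simp add: vRv_def Let_def foldl_vTinv_eq flip: ws_def)
  have Fv: "F v = (\<lambda>T'. c * vRv N lam v (basis T) T')"
    using prodT_inverse[OF set, of "F v"] unfolding c(2) R sgnprod_scale by simp
  \<comment> \<open>The witness for the lower coefficients is \<open>F\<close> itself.\<close>
  have "F \<beta> T' = (if \<beta> = v then c * vRv N lam v (basis T) T' else 0) + (if tri_lt N \<beta> v then F \<beta> T' else 0)"
    for \<beta> T'
  proof (cases "\<beta> = v")
    case True
    then show ?thesis using fun_cong[OF Fv] by (simp add: tri_lt_def)
  next
    case False
    then show ?thesis using below[of \<beta>] by (cases "F \<beta> = zero_vec") (simp_all add: A_def)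
  qed
  with c(1) show ?thesis by blast
qed

end
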